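(* Let $\tau>0$. For $0<\rho<1$ and $t\in\mathbb{R}$ let $\mathcal{D}_{\tau,\rho}(t)=F_\rho(t)-\mathcal{H}_{\tau,\rho}(t)$ be the Abel-regularized difference between the full flat trace and the sum of the four traces with Hardy projectors, and let $\mathcal{D}_\tau$ be the Abel limit of $\mathcal{D}_{\tau,\rho}$ as $\rho\uparrow1$ in the sense of distributions. Then $\mathcal{D}_\tau$ is not a smooth function: there is no smooth function near $2\pi k$, for any $k\in\mathbb{Z}$, that is the distributional Abel limit of $\mathcal{D}_{\tau,\rho}$ near $2\pi k$. More precisely, for $t_0=2\pi k$ with $k\in\mathbb{Z}$, $$\mathcal{D}_{\tau,\rho}(t_0)=(-1)^k\sum_{\ell=0}^\infty\rho^\ell(2\ell+1)\bigl((2\ell+1)-2-2s_\ell(\tau)\bigr),$$ and, as $\rho\uparrow1$, $$\mathcal{D}_{\tau,\rho}(t_0)=(-1)^k\left(\frac{8}{(1-\rho)^3}-\frac{12}{(1-\rho)^2}+\frac{3}{1-\rho}+O_\tau(1)\right).$$ In particular, the full flat trace is not equal to the sum of the four traces with Hardy projectors modulo a smooth function near any geodesic period $t_0=2\pi k$.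
   Context: $E_2\in\mathfrak{so}(3)$ is the infinitesimal rotation with $E_2e_1=-e_3$, $E_2e_2=0$, $E_2e_3=e_1$; $E_1,E_3$ are defined by $E_1e_1=0,\ E_1e_2=e_3,\ E_1e_3=-e_2$ and $E_3e_1=e_2,\ E_3e_2=-e_1,\ E_3e_3=0$. Put $g_t=\exp(-tE_2)\in\mathrm{SO}(3)$. $V_\ell$ ($\ell\in\mathbb{N}_0$) is the irreducible unitary $\mathrm{SO}(3)$ representation of dimension $2\ell+1$, with character $\chi_\ell$, and $\pi_\ell^*$ is the contragredient representation on $V_\ell^*$. Via a fixed equivariant unitary identification, $V_\ell^*\simeq V_\ell\simeq\mathrm{Sym}^{2\ell}\mathbb{C}^2$, the homogeneous polynomials of degree $2\ell$ in $(z_0,z_1)$, with Lie algebra action $$E_1+iE_2\mapsto z_0\partial_{z_1},\quad -E_1+iE_2\mapsto z_1\partial_{z_0},\quad 2iE_3\mapsto z_0\partial_{z_0}-z_1\partial_{z_1},$$ and with the invariant inner product for which monomials are orthogonal and $\|z_0^{2\ell-k}z_1^k\|^2=\binom{2\ell}{k}^{-1}$. Put $u_\ell=z_0^{2\ell}$, $w_\ell(\tau)=(z_0^2+z_1^2+2\coth\tau\,z_0z_1)^\ell$, $\widehat v=v/\|v\|$, $s_\ell(\tau)=|\langle\widehat w_\ell(\tau),\widehat u_\ell\rangle|^2$, and let $P_{h,\ell}$, $P_{\tau,\ell}$ be the orthogonal rank-one projectors of $V_\ell^*$ onto $\mathbb{C}\widehat u_\ell$ and $\mathbb{C}\widehat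 w_\ell(\tau)$. On $L^2(\mathrm{SO}(3))\simeq\bigoplus_\ell V_\ell\otimes V_\ell^*$ let $\widetilde V_g^t$ act on the $\ell$th block by $e^{it/2}\,\mathrm{Id}_{V_\ell}\otimes\pi_\ell^*(g_t)$, and let $\Pi_h,\Pi_\tau$ be the Hardy projectors, acting on the $\ell$th block by $\mathrm{Id}_{V_\ell}\otimes P_{h,\ell}$ and $\mathrm{Id}_{V_\ell}\otimes P_{\tau,\ell}$. The full flat trace $\mathrm{Tr}^\flat(\widetilde V_g^t)$ and the four traces $T_{ab}(t)=\mathrm{Tr}(\Pi_a\widetilde V_g^t\Pi_b)$, $a,b\in\{h,\tau\}$, are understood through the Abel regularizations, for $0<\rho<1$, $$F_\rho(t)=e^{it/2}\sum_{\ell\ge0}\rho^\ell(2\ell+1)\chi_\ell(g_t),\qquad T_{ab,\rho}(t)=e^{it/2}\sum_{\ell\ge0}\rho^\ell(2\ell+1)\,\mathrm{Tr}_{V_\ell^*}\bigl(P_{a,\ell}\,\pi_\ell^*(g_t)\,P_{b,\ell}\bigr),$$ as $\rho\uparrow1$. The sum of the four traces with Hardy projectors is $\mathcal{H}_\tau=T_{hh}+T_{\tau\tau}+T_{h\tau}+T_{\tau h}$, with regularization $\mathcal{H}_{\tau,\rho}=T_{hh,\rho}+T_{\tau\tau,\rho}+T_{h\tau,\rho}+T_{\tau h,\rho}$, and $\mathcal{D}_\tau=\mathrm{Tr}^\flat(\widetilde V_g^t)-\mathcal{H}_\tau$. *)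

theory Defs
  imports "HOL-Analysis.Analysis" "HOL-Computational_Algebra.Polynomial"
begin

subsection \<open>The group SO(3) and its infinitesimal rotations\<close>

definition SO3 :: "(real^3^3) set" where
  "SO3 = {g. rotation_matrix g}"

definition E1 :: "real^3^3" where
  "E1 = vector [vector [0, 0, 0], vector [0, 0, -1], vector [0, 1, 0]]"

definition E2 :: "real^3^3" where
  "E2 = vector [vector [0, 0, 1], vector [0, 0, 0], vector [-1, 0, 0]]"

definition E3 :: "real^3^3" where
  "E3 = vector [vector [0, -1, 0], vector [1, 0, 0], vector [0, 0, 0]]"

lemma E1_action:
  "E1 *v axis 1 1 = 0" "E1 *v axis 2 1 = axis 3 1" "E1 *v axis 3 1 = - axis 2 1"
  by (simp_all add: E1_def vec_eq_iff forall_3 matrix_vector_mult_def sum_3 axis_def)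

lemma E2_action:
  "E2 *v axis 1 1 = - axis 3 1" "E2 *v axis 2 1 = 0" "E2 *v axis 3 1 = axis 1 1"
  by (simp_all add: E2_def vec_eq_iff forall_3 matrix_vector_mult_def sum_3 axis_def)

lemma E3_action:
  "E3 *v axis 1 1 = axis 2 1" "E3 *v axis 2 1 = - axis 1 1" "E3 *v axis 3 1 = 0"
  by (simp_all add: E3_def vec_eq_iff forall_3 matrix_vector_mult_def sum_3 axis_def)

definition mat_exp :: "real^'n^'n \<Rightarrow> real^'n^'n" where
  "mat_exp A = (\<Sum>n. (1 / fact n) *\<^sub>R (((**) A) ^^ n) (mat 1))"

definition g_rot :: "real \<Rightarrow> real^3^3" where
  "g_rot t = mat_exp ((- t) *\<^sub>R E2)"


subsection \<open>Binary forms of degree \<open>2 * l\<close>\<close>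

text \<open>
  A polynomial in \<open>z0, z1\<close> is an element of \<open>complex poly poly\<close>: the outer variable is \<open>z1\<close>,
  the inner one is \<open>z0\<close>, so that \<open>coeff (coeff p j) i\<close> is the coefficient of \<open>z0 ^ i * z1 ^ j\<close>.
\<close>

type_synonym bipoly = "complex poly poly"

definition z0 :: bipoly where "z0 = [:[:0, 1:]:]"
definition z1 :: bipoly where "z1 = [:0, 1:]"

definition scale :: "complex \<Rightarrow> bipoly \<Rightarrow> bipoly" where
  "scale c p = smult [:c:] p"

definition d_z0 :: "bipoly \<Rightarrow> bipoly" where "d_z0 p = map_poly pderiv p"
definition d_z1 :: "bipoly \<Rightarrow> bipoly" where "d_z1 p = pderiv p"

definition Sym :: "nat \<Rightarrow> bipoly set" where
  "Sym l = {p. \<forall>i j. coeff (coeff p j) i \<noteq> 0 \<longrightarrow> i + j = 2 * l}"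

text \<open>The \<open>k\<close>-th monomial \<open>z0 ^ (2 * l - k) * z1 ^ k\<close>, and the coefficient of a form at it.\<close>

definition mono_form :: "nat \<Rightarrow> nat \<Rightarrow> bipoly" where
  "mono_form l k = z0 ^ (2 * l - k) * z1 ^ k"

definition form_coeff :: "nat \<Rightarrow> bipoly \<Rightarrow> nat \<Rightarrow> complex" where
  "form_coeff l p k = coeff (coeff p k) (2 * l - k)"

text \<open>
  The Hermitian inner product, linear in its first argument, for which the monomials are
  orthogonal with \<open>ip l (mono_form l k) (mono_form l k) = 1 / (2 * l choose k)\<close>.
\<close>

definition ip :: "nat \<Rightarrow> bipoly \<Rightarrow> bipoly \<Rightarrow> complex" where
  "ip l p q = (\<Sum>k\<le>2 * l. form_coeff l p k * cnj (form_coeff l q k) / of_nat (2 * l choose k))"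

definition form_norm :: "nat \<Rightarrow> bipoly \<Rightarrow> real" where
  "form_norm l p = sqrt (Re (ip l p p))"

definition normalize_form :: "nat \<Rightarrow> bipoly \<Rightarrow> bipoly" where
  "normalize_form l p = scale (of_real (1 / form_norm l p)) p"

definition linear_on_Sym :: "nat \<Rightarrow> (bipoly \<Rightarrow> bipoly) \<Rightarrow> bool" where
  "linear_on_Sym l T \<longleftrightarrow>
     (\<forall>p\<in>Sym l. T p \<in> Sym l) \<and>
     (\<forall>p\<in>Sym l. \<forall>q\<in>Sym l. T (p + q) = T p + T q) \<and>
     (\<forall>c. \<forall>p\<in>Sym l. T (scale c p) = scale c (T p))"

text \<open>Trace of an operator on \<open>Sym l\<close>, computed in the monomial basis.\<close>

definition Tr :: "nat \<Rightarrow> (bipoly \<Rightarrow> bipoly) \<Rightarrow> complex" where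
  "Tr l T = (\<Sum>k\<le>2 * l. form_coeff l (T (mono_form l k)) k)"


subsection \<open>The irreducible unitary representations\<close>

definition unitary_rep :: "nat \<Rightarrow> (real^3^3 \<Rightarrow> bipoly \<Rightarrow> bipoly) \<Rightarrow> bool" where
  "unitary_rep l R \<longleftrightarrow>
     (\<forall>g\<in>SO3. linear_on_Sym l (R g)) \<and>
     (\<forall>p\<in>Sym l. R (mat 1) p = p) \<and>
     (\<forall>g\<in>SO3. \<forall>h\<in>SO3. \<forall>p\<in>Sym l. R (g ** h) p = R g (R h p)) \<and>
     (\<forall>g\<in>SO3. \<forall>p\<in>Sym l. \<forall>q\<in>Sym l. ip l (R g p) (R g q) = ip l p q) \<and>
     (\<forall>p\<in>Sym l. \<forall>q\<in>Sym l. continuous_on SO3 (\<lambda>g. ip l (R g p) q))"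

definition irreducible_rep :: "nat \<Rightarrow> (real^3^3 \<Rightarrow> bipoly \<Rightarrow> bipoly) \<Rightarrow> bool" where
  "irreducible_rep l R \<longleftrightarrow>
     (\<forall>W \<subseteq> Sym l. 0 \<in> W \<longrightarrow> (\<forall>p\<in>W. \<forall>q\<in>W. p + q \<in> W) \<longrightarrow> (\<forall>c. \<forall>p\<in>W. scale c p \<in> W) \<longrightarrow>
        (\<forall>g\<in>SO3. \<forall>p\<in>W. R g p \<in> W) \<longrightarrow> W = {0} \<or> W = Sym l)"

text \<open>
  \<open>A\<close> is the operator by which the Lie algebra element \<open>X\<close> acts: the derivative at \<open>t = 0\<close> of
  \<open>R (exp (t X))\<close>, taken coefficientwise.
\<close>

definition lie_action ::
  "nat \<Rightarrow> (real^3^3 \<Rightarrow> bipoly \<Rightarrow> bipoly) \<Rightarrow> real^3^3 \<Rightarrow> (bipoly \<Rightarrow> bipoly) \<Rightarrow> bool" where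
  "lie_action l R X A \<longleftrightarrow> linear_on_Sym l A \<and>
     (\<forall>p\<in>Sym l. \<forall>k\<le>2 * l.
        ((\<lambda>t. form_coeff l (R (mat_exp (t *\<^sub>R X)) p) k)
           has_vector_derivative form_coeff l (A p) k) (at 0))"

text \<open>
  The model representation. Since \<open>V\<^sub>l\<^sup>* \<simeq> V\<^sub>l \<simeq> Sym l\<close> equivariantly, the representation on \<open>V\<^sub>l\<close>
  and the contragredient one on \<open>V\<^sub>l\<^sup>*\<close> become the same \<open>R\<close> on \<open>Sym l\<close>. The infinitesimal action
  determines \<open>R\<close> on \<open>SO3\<close> uniquely.
\<close>

definition SO3_model_rep :: "nat \<Rightarrow> (real^3^3 \<Rightarrow> bipoly \<Rightarrow> bipoly) \<Rightarrow> bool" where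
  "SO3_model_rep l R \<longleftrightarrow> unitary_rep l R \<and> irreducible_rep l R \<and>
     (\<exists>A1 A2 A3. lie_action l R E1 A1 \<and> lie_action l R E2 A2 \<and> lie_action l R E3 A3 \<and>
        (\<forall>p\<in>Sym l.
           A1 p + scale \<i> (A2 p) = z0 * d_z1 p \<and>
           - A1 p + scale \<i> (A2 p) = z1 * d_z0 p \<and>
           scale (2 * \<i>) (A3 p) = z0 * d_z0 p - z1 * d_z1 p))"

definition character :: "nat \<Rightarrow> (real^3^3 \<Rightarrow> bipoly \<Rightarrow> bipoly) \<Rightarrow> real^3^3 \<Rightarrow> complex" where
  "character l R g = Tr l (R g)"


subsection \<open>The vectors and projectors\<close>

definition u_vec :: "nat \<Rightarrow> bipoly" where
  "u_vec l = z0 ^ (2 * l)"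

text \<open>\<open>cosh \<tau> / sinh \<tau>\<close> is the hyperbolic cotangent.\<close>

definition w_vec :: "real \<Rightarrow> nat \<Rightarrow> bipoly" where
  "w_vec \<tau> l = (z0\<^sup>2 + z1\<^sup>2 + scale (of_real (2 * (cosh \<tau> / sinh \<tau>))) (z0 * z1)) ^ l"

definition s_coef :: "real \<Rightarrow> nat \<Rightarrow> real" where
  "s_coef \<tau> l = (cmod (ip l (normalize_form l (w_vec \<tau> l)) (normalize_form l (u_vec l))))\<^sup>2"

definition line_proj :: "nat \<Rightarrow> bipoly \<Rightarrow> bipoly \<Rightarrow> bipoly" where
  "line_proj l v p = scale (ip l p (normalize_form l v)) (normalize_form l v)"

definition P_h :: "nat \<Rightarrow> bipoly \<Rightarrow> bipoly" where
  "P_h l = line_proj l (u_vec l)"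

definition P_tau :: "real \<Rightarrow> nat \<Rightarrow> bipoly \<Rightarrow> bipoly" where
  "P_tau \<tau> l = line_proj l (w_vec \<tau> l)"


subsection \<open>Abel-regularized traces\<close>

context
  fixes R :: "nat \<Rightarrow> real^3^3 \<Rightarrow> bipoly \<Rightarrow> bipoly"
begin

definition F_abel :: "real \<Rightarrow> real \<Rightarrow> complex" where
  "F_abel \<rho> t = exp (\<i> * of_real t / 2) *
     (\<Sum>l. of_real (\<rho> ^ l) * of_nat (2 * l + 1) * character l (R l) (g_rot t))"

definition T_abel ::
  "(nat \<Rightarrow> bipoly \<Rightarrow> bipoly) \<Rightarrow> (nat \<Rightarrow> bipoly \<Rightarrow> bipoly) \<Rightarrow> real \<Rightarrow> real \<Rightarrow> complex" where
  "T_abel P Q \<rho> t = exp (\<i> * of_real t / 2) *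
     (\<Sum>l. of_real (\<rho> ^ l) * of_nat (2 * l + 1) * Tr l (P l \<circ> R l (g_rot t) \<circ> Q l))"

definition H_abel :: "real \<Rightarrow> real \<Rightarrow> real \<Rightarrow> complex" where
  "H_abel \<tau> \<rho> t =
     T_abel P_h P_h \<rho> t + T_abel (P_tau \<tau>) (P_tau \<tau>) \<rho> t +
     T_abel P_h (P_tau \<tau>) \<rho> t + T_abel (P_tau \<tau>) P_h \<rho> t"

definition D_abel :: "real \<Rightarrow> real \<Rightarrow> real \<Rightarrow> complex" where
  "D_abel \<tau> \<rho> t = F_abel \<rho> t - H_abel \<tau> \<rho> t"

end


subsection \<open>Smooth functions and distributional Abel limits\<close>

definition smooth_on :: "real set \<Rightarrow> (real \<Rightarrow> complex) \<Rightarrow> bool" where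
  "smooth_on U f \<longleftrightarrow> (\<exists>f' :: nat \<Rightarrow> real \<Rightarrow> complex.
     (\<forall>t\<in>U. f' 0 t = f t) \<and>
     (\<forall>n. \<forall>t\<in>U. (f' n has_vector_derivative f' (Suc n) t) (at t)))"

definition test_function :: "real set \<Rightarrow> (real \<Rightarrow> complex) \<Rightarrow> bool" where
  "test_function U \<phi> \<longleftrightarrow> smooth_on UNIV \<phi> \<and>
     compact (closure {t. \<phi> t \<noteq> 0}) \<and> closure {t. \<phi> t \<noteq> 0} \<subseteq> U"

text \<open>For open \<open>U\<close>: \<open>G \<rho> \<longlongrightarrow> f\<close> in the sense of distributions on \<open>U\<close> as \<open>\<rho>\<close> increases to 1.\<close>

definition abel_limit_on ::
  "real set \<Rightarrow> (real \<Rightarrow> real \<Rightarrow> complex) \<Rightarrow> (real \<Rightarrow> complex) \<Rightarrow> bool" where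
  "abel_limit_on U G f \<longleftrightarrow> (\<forall>\<phi>. test_function U \<phi> \<longrightarrow>
     ((\<lambda>\<rho>. LINT t|lborel. G \<rho> t * \<phi> t) \<longlongrightarrow> (LINT t|lborel. f t * \<phi> t)) (at_left 1))"

definition smooth_abel_limit_near :: "real \<Rightarrow> (real \<Rightarrow> real \<Rightarrow> complex) \<Rightarrow> bool" where
  "smooth_abel_limit_near t0 G \<longleftrightarrow>
     (\<exists>U f. open U \<and> t0 \<in> U \<and> smooth_on U f \<and> abel_limit_on U G f)"

text \<open>Equality, modulo a smooth function near \<open>t0\<close>, of two traces given by their regularizations.\<close>

definition eq_mod_smooth_near ::
  "real \<Rightarrow> (real \<Rightarrow> real \<Rightarrow> complex) \<Rightarrow> (real \<Rightarrow> real \<Rightarrow> complex) \<Rightarrow> bool" where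
  "eq_mod_smooth_near t0 F G \<longleftrightarrow> smooth_abel_limit_near t0 (\<lambda>\<rho> t. F \<rho> t - G \<rho> t)"

end

theory Submission
  imports Defs
begin

text \<open>
  The nonexistence of a smooth limit is seen by pairing the regularized difference with
  \<open>\<phi> t = exp (- \<i> * t / 2) * \<psi> t\<close>, where \<open>\<psi>\<close> is a smooth plateau function of width \<open>a\<close>
  around \<open>2 * pi * k\<close>. The full trace is \<open>exp (\<i> * t / 2)\<close> times a kernel which is bounded away from
  \<open>2 * pi * \<int>\<close> uniformly in \<open>\<rho>\<close> and has integral \<open>2 * pi * S \<rho>\<close> over a period, where
  \<open>S \<rho> = (\<Sum>l. \<rho> ^ l * (2 * l + 1))\<close>; its pairing is therefore at least \<open>2 * pi * S \<rho> - O(1)\<close>.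
  By Cauchy-Schwarz and unitarity the traces with equal projectors are bounded pointwise by \<open>S \<rho>\<close>
  each, and the mixed ones by a constant, because \<open>s_coef \<tau> l\<close> decays geometrically; so the four
  traces contribute at most \<open>12 * a * S \<rho> + O(1)\<close>. For small \<open>a\<close> the pairing tends to infinity.

  At a period the rotation is the identity, every trace is explicit, and the geometric decay of
  \<open>s_coef \<tau> l\<close> makes its contribution the bounded error term.
\<close>

subsection \<open>Rotations\<close>

lemma scaleR_matrix_mult:
  fixes A B C :: "real^'n^'n"
  shows "(c *\<^sub>R A) ** B = c *\<^sub>R (A ** B)" "A ** (c *\<^sub>R B) = c *\<^sub>R (A ** B)"
    "(- A) ** B = - (A ** B)" "A ** (- B) = - (A ** B)"
    "A ** (B - C) = A ** B - A ** C"
  by (simp_all add: algebra_simps sum_subtractf matrix_matrix_mult_def vec_eq_iff sum_distrib_left sum_negf mult_ac)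

text \<open>Rodrigues' formula. Since the cube of \<open>E\<close> is \<open>- E\<close>, its powers
  alternate up to sign between \<open>E\<close> and \<open>E ** E\<close>; the exponential series
  splits into the sine series on the first and that of \<open>1 - cos t\<close> on the
  second.\<close>

lemma sums_mat_exp_generator:
  fixes E :: "real^'n^'n"
  assumes E3: "E ** (E ** E) = - E"
  shows "(\<lambda>n. (1 / fact n) *\<^sub>R (((**) (t *\<^sub>R E)) ^^ n) (mat 1)) sums
    (mat 1 + sin t *\<^sub>R E + (1 - cos t) *\<^sub>R (E ** E))"
proof -
  have pow: "(1 / fact n) *\<^sub>R (((**) (t *\<^sub>R E)) ^^ n) (mat 1) =
      (if n = 0 then mat 1 else 0) + (sin_coeff n * t ^ n) *\<^sub>R E
      + ((if n = 0 then 1 else 0) - cos_coeff n * t ^ n) *\<^sub>R (E ** E)" for n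
  proof -
    \<comment> \<open>Clearing the factorial leaves the recurrences of \<open>sin_coeff\<close> and
      \<open>cos_coeff\<close>. The summands at \<open>n = 0\<close> hold the identity matrix, which
      in general is no combination of \<open>E\<close> and \<open>E ** E\<close>.\<close>
    have *: "(((**) (t *\<^sub>R E)) ^^ n) (mat 1) =
      (if n = 0 then mat 1 else 0) + (fact n * sin_coeff n * t ^ n) *\<^sub>R E
      + (fact n * ((if n = 0 then 1 else 0) - cos_coeff n * t ^ n)) *\<^sub>R (E ** E)"
    proof (induction n)
      case 0
      then show ?case by (simp add: sin_coeff_def cos_coeff_def)
    next
      case (Suc n)
      have s: "fact (Suc n) * sin_coeff (Suc n) = (fact n * cos_coeff n :: real)"
        "fact (Suc n) * cos_coeff (Suc n) = (- fact n * sin_coeff n :: real)"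
        by (simp_all add: sin_coeff_Suc cos_coeff_Suc del: of_nat_Suc)
      have "(((**) (t *\<^sub>R E)) ^^ Suc n) (mat 1) =
         (if n = 0 then t *\<^sub>R E else 0) + (fact n * sin_coeff n * t ^ Suc n) *\<^sub>R (E ** E)
        - (t * fact n * ((if n = 0 then 1 else 0) - cos_coeff n * t ^ n)) *\<^sub>R E"
        by (simp add: Suc.IH matrix_add_ldistrib scaleR_matrix_mult E3 algebra_simps)
      also have "\<dots> = (fact n * cos_coeff n * t ^ Suc n) *\<^sub>R E
         + (fact n * sin_coeff n * t ^ Suc n) *\<^sub>R (E ** E)"
        by (cases "n = 0") (simp_all add: algebra_simps)
      also have "\<dots> = (fact (Suc n) * sin_coeff (Suc n) * t ^ Suc n) *\<^sub>R E
         + (fact (Suc n) * (- cos_coeff (Suc n)) * t ^ Suc n) *\<^sub>R (E ** E)"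
        unfolding mult_minus_right s by simp
      finally show ?case by (simp add: algebra_simps)
    qed
    show ?thesis unfolding * by (simp add: scaleR_add_right)
  qed
  have "(\<lambda>n. sin_coeff n * t ^ n) sums sin t" "(\<lambda>n. cos_coeff n * t ^ n) sums cos t"
    using sin_converges[of t] cos_converges[of t] by simp_all
  moreover have "(\<lambda>n. if n = 0 then mat 1 else 0) sums (mat 1 :: real^'n^'n)"
    "(\<lambda>n::nat. if n = 0 then 1 else 0) sums (1::real)"
    using sums_single[of 0 "\<lambda>_. mat 1 :: real^'n^'n"] sums_single[of 0 "\<lambda>_. 1::real"] by simp_all
  ultimately show ?thesis
    unfolding pow by (intro sums_add sums_scaleR_left sums_diff)
qed

lemma mat_exp_generator:
  fixes E :: "real^'n^'n"
  assumes "E ** (E ** E) = - E"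
  shows "mat_exp (t *\<^sub>R E) = mat 1 + sin t *\<^sub>R E + (1 - cos t) *\<^sub>R (E ** E)"
  unfolding mat_exp_def using sums_mat_exp_generator[OF assms] by (rule sums_unique[symmetric])

lemma E2_cubed: "E2 ** (E2 ** E2) = - E2"
  by (simp add: E2_def vec_eq_iff forall_3 matrix_matrix_mult_def sum_3)

lemma E3_cubed: "E3 ** (E3 ** E3) = - E3"
  by (simp add: E3_def vec_eq_iff forall_3 matrix_matrix_mult_def sum_3)

lemma mat_exp_E3:
  "mat_exp (t *\<^sub>R E3) = vector [vector [cos t, - sin t, 0], vector [sin t, cos t, 0], vector [0, 0, 1]]"
  by (simp add: mat_exp_generator[OF E3_cubed])
     (simp add: E3_def vec_eq_iff forall_3 matrix_matrix_mult_def sum_3 mat_def)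

lemma g_rot_eq:
  "g_rot t = vector [vector [cos t, 0, - sin t], vector [0, 1, 0], vector [sin t, 0, cos t]]"
  unfolding g_rot_def
  by (simp add: mat_exp_generator[OF E2_cubed] flip: scaleR_minus_left)
     (simp add: E2_def vec_eq_iff forall_3 matrix_matrix_mult_def sum_3 mat_def)

text \<open>The one-parameter group law, which in \<open>rep_E3_mono_form\<close> carries a
  derivative known at 0 to every \<open>t\<close>.\<close>

lemma mat_exp_E3_add: "mat_exp ((s + t) *\<^sub>R E3) = mat_exp (s *\<^sub>R E3) ** mat_exp (t *\<^sub>R E3)"
  unfolding mat_exp_E3
  by (simp add: vec_eq_iff forall_3 matrix_matrix_mult_def sum_3 sin_add cos_add algebra_simps)

lemma mat_exp_0: "mat_exp (0 :: real^3^3) = mat 1"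
  using mat_exp_E3[of 0] by (simp add: vec_eq_iff forall_3 mat_def)

lemma mat_exp_E3_SO3: "mat_exp (t *\<^sub>R E3) \<in> SO3"
  unfolding SO3_def mat_exp_E3
  by (simp add: rotation_matrix_def orthogonal_matrix det_3 vec_eq_iff forall_3
      matrix_matrix_mult_def sum_3 transpose_def mat_def flip: power2_eq_square)

lemma g_rot_SO3: "g_rot t \<in> SO3"
  unfolding SO3_def g_rot_eq
  by (simp add: rotation_matrix_def orthogonal_matrix det_3 vec_eq_iff forall_3
      matrix_matrix_mult_def sum_3 transpose_def mat_def flip: power2_eq_square)

lemma g_rot_period: "g_rot (2 * pi * of_int k) = mat 1"
  by (simp add: g_rot_eq vec_eq_iff forall_3 mat_def)

lemma continuous_g_rot: "continuous_on UNIV g_rot"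
  by (auto simp: g_rot_def mat_exp_generator[OF E2_cubed] simp flip: scaleR_minus_left
      intro!: continuous_intros)

text \<open>The rotation \<open>e1 \<mapsto> e2 \<mapsto> e3 \<mapsto> e1\<close> conjugates \<open>E2\<close> to \<open>E3\<close>, which is diagonal on monomials.\<close>

definition cyc :: "real^3^3" where
  "cyc = vector [vector [0, 0, 1], vector [1, 0, 0], vector [0, 1, 0]]"

lemma cyc_SO3: "cyc \<in> SO3" "transpose cyc \<in> SO3"
  by (simp_all add: SO3_def cyc_def rotation_matrix_def orthogonal_matrix det_3 vec_eq_iff forall_3
      matrix_matrix_mult_def sum_3 transpose_def mat_def)

lemma cyc_inverse: "cyc ** transpose cyc = mat 1"
  by (simp add: cyc_def vec_eq_iff forall_3 matrix_matrix_mult_def sum_3 transpose_def mat_def)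

lemma g_rot_conj: "g_rot t = transpose cyc ** (mat_exp ((- t) *\<^sub>R E3) ** cyc)"
  by (simp add: mat_exp_E3 g_rot_eq cyc_def vec_eq_iff forall_3 matrix_matrix_mult_def sum_3 transpose_def
       del: scaleR_minus_left)

subsection \<open>Binary forms\<close>

lemma z0_power: "z0 ^ a = [:monom 1 a:]"
  by (induction a) (simp_all add: z0_def monom_0 monom_Suc one_pCons)

lemma z1_power: "z1 ^ k = monom 1 k"
  by (induction k) (simp_all add: z1_def monom_0 monom_Suc)

lemma mono_form_eq: "mono_form l k = monom (monom 1 (2 * l - k)) k"
  by (simp add: mono_form_def z0_power z1_power smult_monom)

lemma form_coeff_add: "form_coeff l (p + q) k = form_coeff l p k + form_coeff l q k"
  by (simp add: form_coeff_def)

lemma form_coeff_scale: "form_coeff l (scale c p) k = c * form_coeff l p k"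
  by (simp add: form_coeff_def scale_def)

lemma form_coeff_0 [simp]: "form_coeff l 0 k = 0"
  by (simp add: form_coeff_def)

lemma form_coeff_sum: "form_coeff l (sum f A) k = (\<Sum>i\<in>A. form_coeff l (f i) k)"
  by (induction A rule: infinite_finite_induct) (simp_all add: form_coeff_add)

lemma form_coeff_mono_form: "form_coeff l (mono_form l j) k = (if j = k then 1 else 0)"
  by (simp add: form_coeff_def mono_form_eq)

lemma mono_form_in_Sym: "k \<le> 2 * l \<Longrightarrow> mono_form l k \<in> Sym l"
  by (auto simp: Sym_def mono_form_eq split: if_splits)

lemma Sym_0: "0 \<in> Sym l"
  by (simp add: Sym_def)

lemma Sym_add: "p \<in> Sym l \<Longrightarrow> q \<in> Sym l \<Longrightarrow> p + q \<in> Sym l"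
  unfolding Sym_def by (simp, metis add.right_neutral)

lemma Sym_scale: "p \<in> Sym l \<Longrightarrow> scale c p \<in> Sym l"
  by (auto simp: Sym_def scale_def)

lemma Sym_sum: "(\<And>i. i \<in> A \<Longrightarrow> f i \<in> Sym l) \<Longrightarrow> sum f A \<in> Sym l"
  by (induction A rule: infinite_finite_induct) (simp_all add: Sym_add Sym_0)

lemma Sym_mult:
  assumes "p \<in> Sym l" "q \<in> Sym m"
  shows "p * q \<in> Sym (l + m)"
proof -
  have "i + j = 2 * (l + m)" if "coeff (coeff (p * q) j) i \<noteq> 0" for i j
  proof -
    have "(\<Sum>a\<le>j. \<Sum>b\<le>i. coeff (coeff p a) b * coeff (coeff q (j - a)) (i - b)) \<noteq> 0"
      using that by (simp add: coeff_mult coeff_sum)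
    then obtain a b where "a \<le> j" "b \<le> i" "coeff (coeff p a) b \<noteq> 0" "coeff (coeff q (j - a)) (i - b) \<noteq> 0"
      by (metis (no_types, lifting) atMost_iff mult_eq_0_iff sum.neutral)
    moreover from this have "b + a = 2 * l" "(i - b) + (j - a) = 2 * m"
      using assms unfolding Sym_def by blast+
    ultimately show ?thesis by simp
  qed
  then show ?thesis by (simp add: Sym_def)
qed

text \<open>Off the diagonal \<open>i + j = 2 * l\<close> both forms have zero coefficients, and on
  it \<open>form_coeff\<close> reads all of them.\<close>

lemma Sym_eqI:
  assumes "p \<in> Sym l" "q \<in> Sym l" "\<And>k. k \<le> 2 * l \<Longrightarrow> form_coeff l p k = form_coeff l q k"
  shows "p = q"
proof (intro poly_eqI)
  fix j i
  show "coeff (coeff p j) i = coeff (coeff q j) i"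
  proof (cases "i + j = 2 * l")
    case True
    then have "i = 2 * l - j" "j \<le> 2 * l" by auto
    with assms(3)[of j] show ?thesis by (simp add: form_coeff_def)
  next
    case False
    with assms(1,2) show ?thesis by (metis (mono_tags, lifting) Sym_def mem_Collect_eq)
  qed
qed

lemma Sym_expand:
  assumes "p \<in> Sym l"
  shows "p = (\<Sum>k\<le>2 * l. scale (form_coeff l p k) (mono_form l k))"
  using assms
  by (intro Sym_eqI[of _ l] Sym_sum)
     (simp_all add: Sym_scale mono_form_in_Sym form_coeff_sum form_coeff_scale
        form_coeff_mono_form if_distrib[of "(*) _"] sum.delta' cong: if_cong)

section \<open>Linear operators on forms and their traces\<close>

lemma linear_on_Sym_sum:
  assumes T: "linear_on_Sym l T" and "finite A" "\<And>i. i \<in> A \<Longrightarrow> f i \<in> Sym l"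
  shows "T (\<Sum>i\<in>A. scale (c i) (f i)) = (\<Sum>i\<in>A. scale (c i) (T (f i)))"
  using assms(2,3)
proof (induction A)
  case empty
  \<comment> \<open>The empty sum needs \<open>T 0 = 0\<close>, which is homogeneity with factor
    0.\<close>
  have "T (scale 0 0) = scale 0 (T 0)"
    using T Sym_0 unfolding linear_on_Sym_def by blast
  then show ?case by (simp add: scale_def)
next
  case (insert x A)
  then have "scale (c x) (f x) \<in> Sym l" "(\<Sum>i\<in>A. scale (c i) (f i)) \<in> Sym l"
    by (auto intro!: Sym_scale Sym_sum)
  with T insert show ?case by (simp add: linear_on_Sym_def)
qed

lemma form_coeff_linear:
  assumes "linear_on_Sym l T" "p \<in> Sym l"
  shows "form_coeff l (T p) k = (\<Sum>j\<le>2 * l. form_coeff l p j * form_coeff l (T (mono_form l j)) k)"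
  by (subst Sym_expand[OF assms(2)], subst linear_on_Sym_sum[OF assms(1)])
     (simp_all add: mono_form_in_Sym form_coeff_sum form_coeff_scale)

text \<open>Both sides are one double sum of products of matrix entries in the monomial basis, taken
  in two orders. It gives the conjugation invariance used in \<open>character_g_rot\<close>.\<close>

lemma Tr_comp_commute:
  assumes S: "linear_on_Sym l S" and T: "linear_on_Sym l T"
  shows "Tr l (S \<circ> T) = Tr l (T \<circ> S)"
proof -
  have *: "form_coeff l (S (T (mono_form l k))) k =
      (\<Sum>j\<le>2 * l. form_coeff l (T (mono_form l k)) j * form_coeff l (S (mono_form l j)) k)"
    if "k \<le> 2 * l" "linear_on_Sym l S" "linear_on_Sym l T" for k S T
    using that by (intro form_coeff_linear) (simp_all add: linear_on_Sym_def mono_form_in_Sym)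
  show ?thesis
    unfolding Tr_def o_def using S T
    by (simp add: *) (subst sum.swap, simp add: mult.commute)
qed

lemma Tr_cong: "(\<And>p. p \<in> Sym l \<Longrightarrow> S p = T p) \<Longrightarrow> Tr l S = Tr l T"
  by (simp add: Tr_def mono_form_in_Sym)

lemma linear_on_Sym_comp: "linear_on_Sym l S \<Longrightarrow> linear_on_Sym l T \<Longrightarrow> linear_on_Sym l (S \<circ> T)"
  by (simp add: linear_on_Sym_def)

section \<open>The invariant inner product and rank-one projectors\<close>

lemma ip_scale_left: "ip l (scale c p) q = c * ip l p q"
  by (simp add: ip_def form_coeff_scale sum_distrib_left mult_ac)

lemma ip_self: "ip l p p = of_real (\<Sum>k\<le>2 * l. (cmod (form_coeff l p k))\<^sup>2 / real (2 * l choose k))"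
  by (simp add: ip_def flip: complex_norm_square)

lemma form_norm_sq: "(form_norm l p)\<^sup>2 = (\<Sum>k\<le>2 * l. (cmod (form_coeff l p k))\<^sup>2 / real (2 * l choose k))"
  unfolding form_norm_def ip_self Re_complex_of_real
  by (intro real_sqrt_pow2 sum_nonneg) simp

lemma form_norm_nonneg: "form_norm l p \<ge> 0"
  unfolding form_norm_def ip_self Re_complex_of_real
  by (intro real_sqrt_ge_zero sum_nonneg) simp

lemma ip_self_norm: "ip l p p = of_real ((form_norm l p)\<^sup>2)"
  unfolding form_norm_sq ip_self ..

text \<open>The weight is distributed as \<open>1 / sqrt (w k)\<close> on \<open>f\<close> and
  \<open>sqrt (w k)\<close> on \<open>g\<close>. With binomial weights the first factor becomes
  \<open>(form_norm l p)\<^sup>2\<close>.\<close>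

lemma sum_weighted_Cauchy_Schwarz:
  fixes f g w :: "'a \<Rightarrow> real"
  assumes "\<And>k. k \<in> A \<Longrightarrow> w k > 0"
  shows "(\<Sum>k\<in>A. f k * g k)\<^sup>2 \<le> (\<Sum>k\<in>A. (f k)\<^sup>2 / w k) * (\<Sum>k\<in>A. (g k)\<^sup>2 * w k)"
proof -
  have "(\<Sum>k\<in>A. f k * g k) = (\<Sum>k\<in>A. (f k / sqrt (w k)) * (g k * sqrt (w k)))"
    using assms by (intro sum.cong) (auto simp: less_imp_neq[THEN not_sym])
  also have "\<dots>\<^sup>2 \<le> (\<Sum>k\<in>A. (f k / sqrt (w k))\<^sup>2) * (\<Sum>k\<in>A. (g k * sqrt (w k))\<^sup>2)"
    by (rule Cauchy_Schwarz_ineq_sum)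
  also have "\<dots> = (\<Sum>k\<in>A. (f k)\<^sup>2 / w k) * (\<Sum>k\<in>A. (g k)\<^sup>2 * w k)"
    using assms by (intro arg_cong2[where f="(*)"] sum.cong) (auto simp: power_divide power_mult_distrib less_imp_le)
  finally show ?thesis .
qed

lemma ip_Cauchy_Schwarz: "cmod (ip l p q) \<le> form_norm l p * form_norm l q"
proof (rule power2_le_imp_le)
  have "cmod (ip l p q) \<le> (\<Sum>k\<le>2 * l. cmod (form_coeff l p k) * (cmod (form_coeff l q k) / real (2 * l choose k)))"
    unfolding ip_def by (rule sum_norm_le) (simp add: norm_mult norm_divide)
  then have "(cmod (ip l p q))\<^sup>2 \<le> (\<Sum>k\<le>2 * l. cmod (form_coeff l p k) * (cmod (form_coeff l q k) / real (2 * l choose k)))\<^sup>2"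
    by (intro power_mono) auto
  also have "\<dots> \<le> (\<Sum>k\<le>2 * l. (cmod (form_coeff l p k))\<^sup>2 / real (2 * l choose k)) *
     (\<Sum>k\<le>2 * l. (cmod (form_coeff l q k) / real (2 * l choose k))\<^sup>2 * real (2 * l choose k))"
    \<comment> \<open>The second sequence already contains one inverse binomial, so multiplying its
      square by the binomial leaves the weight of the norm.\<close>
    by (rule sum_weighted_Cauchy_Schwarz) simp
  also have "(\<Sum>k\<le>2 * l. (cmod (form_coeff l q k) / real (2 * l choose k))\<^sup>2 * real (2 * l choose k)) = (form_norm l q)\<^sup>2"
    unfolding form_norm_sq by (intro sum.cong refl) (simp add: power_divide power2_eq_square)
  finally show "(cmod (ip l p q))\<^sup>2 \<le> (form_norm l p * form_norm l q)\<^sup>2"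
    by (simp add: form_norm_sq power_mult_distrib)
qed (simp add: form_norm_nonneg)

lemma form_norm_scale: "form_norm l (scale c p) = cmod c * form_norm l p"
proof (rule power2_eq_imp_eq)
  show "(form_norm l (scale c p))\<^sup>2 = (cmod c * form_norm l p)\<^sup>2"
    by (simp add: form_norm_sq form_coeff_scale norm_mult power_mult_distrib sum_distrib_left mult_ac)
qed (simp_all add: form_norm_nonneg)

lemma normalize_form_norm: "form_norm l p > 0 \<Longrightarrow> form_norm l (normalize_form l p) = 1"
  by (simp add: normalize_form_def form_norm_scale norm_divide)

lemma Sym_normalize: "p \<in> Sym l \<Longrightarrow> normalize_form l p \<in> Sym l"
  by (simp add: normalize_form_def Sym_scale)

text \<open>The composite has rank at most one: it sends \<open>p\<close> to the multiple of the
  unit vector along \<open>v\<close> with factor the pairing of \<open>p\<close> with the unit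
  vector along \<open>w\<close> times a matrix coefficient of \<open>T\<close>. Summing the diagonal
  entries reassembles the overlap of the two unit vectors.\<close>

lemma Tr_line_proj:
  assumes T: "linear_on_Sym l T" and w: "w \<in> Sym l"
  shows "Tr l (line_proj l v \<circ> T \<circ> line_proj l w) =
    ip l (T (normalize_form l w)) (normalize_form l v) * ip l (normalize_form l v) (normalize_form l w)"
proof -
  let ?w = "normalize_form l w" and ?v = "normalize_form l v"
  have "T (scale c ?w) = scale c (T ?w)" for c
    using T Sym_normalize[OF w] by (simp add: linear_on_Sym_def)
  moreover have "ip l (mono_form l k) ?w = cnj (form_coeff l ?w k) / of_nat (2 * l choose k)" if "k \<le> 2 * l" for k
    using that by (simp add: ip_def form_coeff_mono_form if_distrib[of "\<lambda>x. x * _ / _"] sum.delta' cong: if_cong)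
  ultimately show ?thesis
    by (simp add: Tr_def line_proj_def ip_scale_left form_coeff_scale ip_def[of l ?v ?w] sum_distrib_left mult_ac)
qed

lemma ip_cnj: "ip l q p = cnj (ip l p q)"
  by (simp add: ip_def mult_ac)

lemma eval_form:
  assumes "p \<in> Sym l"
  shows "poly (poly p 1) 1 = (\<Sum>k\<le>2 * l. form_coeff l p k)"
  by (subst Sym_expand[OF assms]) (simp add: poly_sum scale_def mono_form_eq poly_monom)

text \<open>Cauchy-Schwarz against the reproducing vector \<open>(z0 + z1) ^ (2 * l)\<close>.\<close>

lemma eval_form_le:
  assumes "p \<in> Sym l"
  shows "(cmod (poly (poly p 1) 1))\<^sup>2 \<le> 4 ^ l * (form_norm l p)\<^sup>2"
proof -
  have "cmod (poly (poly p 1) 1) \<le> (\<Sum>k\<le>2 * l. cmod (form_coeff l p k) * 1)"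
    unfolding eval_form[OF assms] by (rule sum_norm_le) simp
  then have "(cmod (poly (poly p 1) 1))\<^sup>2 \<le> (\<Sum>k\<le>2 * l. cmod (form_coeff l p k) * 1)\<^sup>2"
    by (intro power_mono) auto
  also have "\<dots> \<le> (\<Sum>k\<le>2 * l. (cmod (form_coeff l p k))\<^sup>2 / real (2 * l choose k)) *
     (\<Sum>k\<le>2 * l. 1\<^sup>2 * real (2 * l choose k))"
    by (rule sum_weighted_Cauchy_Schwarz) simp
  also have "(\<Sum>k\<le>2 * l. 1\<^sup>2 * real (2 * l choose k)) = 4 ^ l"
    using choose_row_sum[of "2 * l"] by (simp add: power_mult flip: of_nat_sum)
  finally show ?thesis by (simp add: form_norm_sq mult.commute)
qed

section \<open>The vectors \<open>u_vec\<close> and \<open>w_vec\<close> and their overlap\<close>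

lemma u_vec_eq: "u_vec l = mono_form l 0"
  by (simp add: u_vec_def mono_form_def)

lemma u_vec_in_Sym: "u_vec l \<in> Sym l"
  by (simp add: u_vec_eq mono_form_in_Sym)

lemma form_norm_u_vec: "form_norm l (u_vec l) = 1"
proof -
  have "ip l (u_vec l) (u_vec l) = 1"
    by (simp add: ip_def u_vec_eq form_coeff_mono_form if_distrib[of "\<lambda>x. x * _ / _"] sum.delta' cong: if_cong)
  then show ?thesis by (simp add: form_norm_def)
qed

lemma normalize_u_vec: "normalize_form l (u_vec l) = u_vec l"
  by (simp add: normalize_form_def form_norm_u_vec scale_def flip: one_pCons)

lemma w_vec_in_Sym: "w_vec \<tau> l \<in> Sym l"
proof -
  have "z0\<^sup>2 = mono_form 1 0" "z1\<^sup>2 = mono_form 1 2" "z0 * z1 = mono_form 1 1"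
    by (simp_all add: mono_form_def)
  then have base: "z0\<^sup>2 + z1\<^sup>2 + scale c (z0 * z1) \<in> Sym 1" for c
    by (simp add: Sym_add Sym_scale mono_form_in_Sym)
  have "p ^ l \<in> Sym l" if "p \<in> Sym 1" for p
  proof (induction l)
    case 0
    show ?case by (simp add: Sym_def flip: monom_0)
  next
    case (Suc l)
    then show ?case using Sym_mult[OF that, of "p ^ l" l] by simp
  qed
  with base show ?thesis by (simp add: w_vec_def)
qed

text \<open>At \<open>z0 = z1 = 1\<close> the form takes the value
  \<open>(2 + 2 * coth \<tau>) ^ l\<close>, at least \<open>4 ^ l\<close> because
  \<open>coth \<tau> \<ge> 1\<close>. Evaluation there enlarges the norm by at most the factor
  \<open>2 ^ l\<close>, so at least \<open>2 ^ l\<close> is left for the norm.\<close>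

lemma form_norm_w_vec_ge:
  assumes "\<tau> > 0"
  shows "2 ^ l \<le> form_norm l (w_vec \<tau> l)"
proof -
  define c where "c = cosh \<tau> / sinh \<tau>"
  have "0 < sinh \<tau>" "sinh \<tau> < cosh \<tau>" using assms by (simp_all add: sinh_less_cosh_real)
  then have c: "1 \<le> c" by (simp add: c_def)
  have "poly (poly (w_vec \<tau> l) 1) 1 = of_real ((2 + 2 * c) ^ l)"
    unfolding w_vec_def c_def[symmetric]
    by (simp add: z0_def z1_def scale_def poly_power)
  then have "((2 + 2 * c) ^ l)\<^sup>2 \<le> 4 ^ l * (form_norm l (w_vec \<tau> l))\<^sup>2"
    using eval_form_le[OF w_vec_in_Sym[of \<tau> l]] c by (simp del: of_real_power)
  moreover have "(4 ^ l)\<^sup>2 \<le> ((2 + 2 * c) ^ l)\<^sup>2"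
    using c by (intro power_mono) auto
  ultimately have "(4::real) ^ l * (2 ^ l)\<^sup>2 \<le> 4 ^ l * (form_norm l (w_vec \<tau> l))\<^sup>2"
    by (simp add: power2_eq_square flip: power_mult_distrib)
  then have "(2 ^ l)\<^sup>2 \<le> (form_norm l (w_vec \<tau> l))\<^sup>2"
    by (simp add: mult_le_cancel_left)
  then show ?thesis
    by (rule power2_le_imp_le) (rule form_norm_nonneg)
qed

lemma form_norm_w_vec_pos: "\<tau> > 0 \<Longrightarrow> 0 < form_norm l (w_vec \<tau> l)"
  by (rule less_le_trans[OF _ form_norm_w_vec_ge]) simp_all

text \<open>The coefficient of \<open>z0 ^ (2 * l)\<close> in \<open>w_vec \<tau> l\<close> is 1, so
  the pairing with the unit vector \<open>u_vec l\<close> is 1 before normalization and the overlap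
  is the reciprocal of the norm of \<open>w_vec \<tau> l\<close>. This is the source of the
  geometric decay of the mixed traces.\<close>

lemma cmod_ip_w_u_le:
  assumes "\<tau> > 0"
  shows "cmod (ip l (normalize_form l (w_vec \<tau> l)) (normalize_form l (u_vec l))) \<le> (1/2) ^ l"
proof -
  have "[:0, 0, 1:] = monom (1::complex) 2"
    by (simp add: numeral_2_eq_2 monom_Suc monom_0)
  then have pow: "coeff ([:0, 0, 1::complex:] ^ l) (2 * l) = 1"
    by (simp add: monom_power)
  have "form_coeff l (w_vec \<tau> l) 0 = 1"
    unfolding w_vec_def form_coeff_def coeff_0_power
    by (simp add: z0_def z1_def scale_def power2_eq_square pow)
  then have "ip l (w_vec \<tau> l) (u_vec l) = 1"
    by (simp add: ip_def u_vec_eq form_coeff_mono_form if_distrib[of "\<lambda>x. _ * x / _"] if_distrib[of cnj] cong: if_cong)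
  then have "cmod (ip l (normalize_form l (w_vec \<tau> l)) (normalize_form l (u_vec l))) = 1 / form_norm l (w_vec \<tau> l)"
    unfolding normalize_u_vec
    by (simp add: normalize_form_def ip_scale_left norm_divide form_norm_nonneg)
  also have "\<dots> \<le> 1 / 2 ^ l"
    by (intro divide_left_mono form_norm_w_vec_ge assms mult_pos_pos form_norm_w_vec_pos) simp_all
  finally show ?thesis by (simp add: power_divide)
qed

subsection \<open>The character\<close>

text \<open>Monomials are weight vectors: each Euler operator multiplies by an exponent, and the
  difference of the exponents is \<open>(2 * l - k) - k\<close>.\<close>

lemma weight_mono_form:
  assumes "k \<le> 2 * l"
  shows "z0 * d_z0 (mono_form l k) - z1 * d_z1 (mono_form l k) = scale (2 * (of_nat l - of_nat k)) (mono_form l k)"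
proof -
  have "z0 * d_z0 (monom (monom 1 a) k) = scale (of_nat a) (monom (monom 1 a) k)" for a
    by (cases a) (simp_all add: z0_def d_z0_def scale_def map_poly_monom pderiv_monom smult_monom flip: monom_Suc)
  moreover have "z1 * d_z1 (monom p k) = scale (of_nat k) (monom p k)" for p
    by (cases k) (simp_all add: z1_def d_z1_def scale_def pderiv_monom smult_monom of_nat_poly flip: monom_Suc)
  ultimately show ?thesis using assms
    by (simp add: mono_form_eq scale_def of_nat_diff algebra_simps flip: smult_diff_left)
qed

context
  fixes l :: nat and \<rho> :: "real^3^3 \<Rightarrow> bipoly \<Rightarrow> bipoly"
  assumes model: "SO3_model_rep l \<rho>"
begin

lemma rep_linear: "g \<in> SO3 \<Longrightarrow> linear_on_Sym l (\<rho> g)"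
  and rep_one: "p \<in> Sym l \<Longrightarrow> \<rho> (mat 1) p = p"
  and rep_mult: "g \<in> SO3 \<Longrightarrow> h \<in> SO3 \<Longrightarrow> p \<in> Sym l \<Longrightarrow> \<rho> (g ** h) p = \<rho> g (\<rho> h p)"
  and rep_unitary: "g \<in> SO3 \<Longrightarrow> p \<in> Sym l \<Longrightarrow> q \<in> Sym l \<Longrightarrow> ip l (\<rho> g p) (\<rho> g q) = ip l p q"
  and rep_continuous: "p \<in> Sym l \<Longrightarrow> q \<in> Sym l \<Longrightarrow> continuous_on SO3 (\<lambda>g. ip l (\<rho> g p) q)"
  using model unfolding SO3_model_rep_def unitary_rep_def by blast+

lemma rep_in_Sym: "g \<in> SO3 \<Longrightarrow> p \<in> Sym l \<Longrightarrow> \<rho> g p \<in> Sym l"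
  using rep_linear unfolding linear_on_Sym_def by blast

lemma rep_norm: "g \<in> SO3 \<Longrightarrow> p \<in> Sym l \<Longrightarrow> form_norm l (\<rho> g p) = form_norm l p"
  by (simp add: form_norm_def rep_unitary)

text \<open>The model prescribes \<open>2 * \<i>\<close> times the action of \<open>E3\<close> as
  the weight operator, so \<open>E3\<close> itself acts on the monomial by
  \<open>- \<i> * (l - k)\<close>.\<close>

lemma rep_E3_derivative_mono_form:
  assumes k: "k \<le> 2 * l"
  shows "((\<lambda>t. form_coeff l (\<rho> (mat_exp (t *\<^sub>R E3)) (mono_form l k)) j)
    has_vector_derivative - \<i> * (of_nat l - of_nat k) * form_coeff l (mono_form l k) j) (at 0)"
proof (cases "j \<le> 2 * l")
  case True
  obtain A3 where A3: "lie_action l \<rho> E3 A3"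
    "\<And>p. p \<in> Sym l \<Longrightarrow> scale (2 * \<i>) (A3 p) = z0 * d_z0 p - z1 * d_z1 p"
    using model unfolding SO3_model_rep_def by blast
  have "z0 * d_z0 (mono_form l k) - z1 * d_z1 (mono_form l k) = scale (2 * (of_nat l - of_nat k)) (mono_form l k)"
    using k by (simp add: weight_mono_form)
  with A3(2)[OF mono_form_in_Sym[OF k]]
  have "form_coeff l (scale (2 * \<i>) (A3 (mono_form l k))) j =
      form_coeff l (scale (2 * (of_nat l - of_nat k)) (mono_form l k)) j" by simp
  then have "2 * (\<i> * form_coeff l (A3 (mono_form l k)) j) = 2 * ((of_nat l - of_nat k) * form_coeff l (mono_form l k) j)"
    by (simp only: form_coeff_scale mult.assoc)
  then have "\<i> * form_coeff l (A3 (mono_form l k)) j = (of_nat l - of_nat k) * form_coeff l (mono_form l k) j"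
    by (subst (asm) mult_cancel_left) simp
  then have "- \<i> * (\<i> * form_coeff l (A3 (mono_form l k)) j) = - \<i> * ((of_nat l - of_nat k) * form_coeff l (mono_form l k) j)"
    by simp
  then have "form_coeff l (A3 (mono_form l k)) j = - \<i> * (of_nat l - of_nat k) * form_coeff l (mono_form l k) j"
    by (simp add: mult.assoc[symmetric] del: mult_minus_left)
  with A3(1) True mono_form_in_Sym[OF k] show ?thesis unfolding lie_action_def by metis
next
  case False
  \<comment> \<open>For \<open>j > 2 * l\<close> the subtraction in \<open>form_coeff\<close>
    truncates to 0, so the coefficient read is that of \<open>z1 ^ j\<close>, whose degree is too
    large.\<close>
  have "form_coeff l p j = 0" if "p \<in> Sym l" for p
    using that False by (simp add: Sym_def form_coeff_def) (metis add_0 le_refl)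
  then have "(\<lambda>t. form_coeff l (\<rho> (mat_exp (t *\<^sub>R E3)) (mono_form l k)) j) = (\<lambda>t. 0)"
    using k by (intro ext) (simp add: rep_in_Sym mono_form_in_Sym mat_exp_E3_SO3)
  then show ?thesis using False k by (simp add: form_coeff_mono_form)
qed

text \<open>Each coordinate of the orbit solves the linear equation \<open>y' = c * y\<close> with
  \<open>c = - \<i> * (l - k)\<close>, hence is an exponential times its initial value.\<close>

lemma rep_E3_mono_form:
  assumes k: "k \<le> 2 * l"
  shows "\<rho> (mat_exp (t *\<^sub>R E3)) (mono_form l k) = scale (exp (- \<i> * (of_nat l - of_nat k) * of_real t)) (mono_form l k)"
proof -
  define c where "c = - \<i> * (of_nat l - of_nat k)"
  define f where "f j t = form_coeff l (\<rho> (mat_exp (t *\<^sub>R E3)) (mono_form l k)) j" for j t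
  note mem = mono_form_in_Sym[OF k]
  have f0: "f j 0 = form_coeff l (mono_form l k) j" for j
    by (simp add: f_def mat_exp_0 rep_one[OF mem])
  have d0: "(f j has_vector_derivative c * f j 0) (at 0)" for j
    using rep_E3_derivative_mono_form[OF k, of j] by (simp add: f0 c_def) (simp add: f_def[abs_def])
  have d: "(f j has_vector_derivative c * f j t) (at t)" for j t
  proof -
    let ?T = "\<lambda>i. form_coeff l (\<rho> (mat_exp (t *\<^sub>R E3)) (mono_form l i)) j"
    \<comment> \<open>By the group law the coordinates at \<open>t + s\<close> are combinations of
      those at \<open>s\<close> with coefficients independent of \<open>s\<close>, so
      differentiating at \<open>s = 0\<close> gives the derivative at \<open>t\<close>.\<close>
    have add: "f j (t + s) = (\<Sum>i\<le>2 * l. f i s * ?T i)" for s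
      unfolding f_def mat_exp_E3_add
      by (simp add: rep_mult mat_exp_E3_SO3 mem form_coeff_linear rep_linear rep_in_Sym)
    have "((\<lambda>s. \<Sum>i\<le>2 * l. f i s * ?T i) has_vector_derivative (\<Sum>i\<le>2 * l. c * f i 0 * ?T i)) (at 0)"
      by (intro has_vector_derivative_sum has_vector_derivative_mult_left d0)
    also have "(\<Sum>i\<le>2 * l. c * f i 0 * ?T i) = c * f j t"
      using add[of 0] by (simp add: sum_distrib_left mult_ac)
    finally have "((\<lambda>s. f j (t + s)) has_vector_derivative c * f j t) (at 0)" unfolding add .
    then have "((\<lambda>s. f j (t + s)) has_vector_derivative c * f j t) (at (t - t))" by simp
    moreover have "((\<lambda>s. s - t) has_vector_derivative 1) (at t)"
      by (auto intro!: derivative_eq_intros)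
    ultimately have "((\<lambda>s. f j (t + s)) \<circ> (\<lambda>s. s - t) has_vector_derivative 1 *\<^sub>R (c * f j t)) (at t)"
      by (intro vector_diff_chain_at)
    then show ?thesis by (simp add: o_def)
  qed
  have "f j t = exp (c * of_real t) * f j 0" for j
  proof -
    \<comment> \<open>Integrating factor: the product has derivative zero and is therefore
      constant.\<close>
    have "((\<lambda>t. exp (- c * of_real t) * f j t) has_vector_derivative 0) (at t)" for t
    proof -
      have "((\<lambda>t. exp (- c * of_real t)) has_vector_derivative - c * exp (- c * of_real t)) (at t)"
        by (auto intro!: derivative_eq_intros has_vector_derivative_real_field )
      from has_vector_derivative_mult[OF this d[of j t]] show ?thesis by (simp add: algebra_simps)
    qed
    then obtain K where "\<And>t. exp (- c * of_real t) * f j t = K"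
      by (rule has_vector_derivative_zero_constant[of UNIV "\<lambda>t. exp (- c * of_real t) * f j t", OF convex_UNIV]) auto
    then have "exp (- c * of_real t) * f j t = exp (- c * of_real 0) * f j 0" by metis
    then have "exp (c * of_real t) * exp (- c * of_real t) * f j t = exp (c * of_real t) * f j 0"
      by (simp add: mult.assoc)
    then show ?thesis by (simp add: flip: exp_add)
  qed
  then show ?thesis
    by (intro Sym_eqI[of _ l]) (simp_all add: f_def f0[unfolded f_def] form_coeff_scale c_def
         mat_exp_0 rep_one mem Sym_scale rep_in_Sym mat_exp_E3_SO3)
qed

text \<open>Conjugation by \<open>cyc\<close> replaces the rotation by
  \<open>mat_exp ((- t) *\<^sub>R E3)\<close>, which is diagonal on monomials. The sign in
  \<open>- t\<close> cancels that of the eigenvalues \<open>- \<i> * (l - k)\<close>.\<close>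

lemma character_g_rot:
  "character l \<rho> (g_rot t) = (\<Sum>k\<le>2 * l. exp (\<i> * (of_nat l - of_nat k) * of_real t))"
proof -
  let ?D = "mat_exp ((- t) *\<^sub>R E3)"
  note cl = cyc_SO3 mat_exp_E3_SO3 rep_linear
  have SO3_mult: "g ** h \<in> SO3" if "g \<in> SO3" "h \<in> SO3" for g h
    using that unfolding SO3_def rotation_matrix_def by (auto simp: orthogonal_matrix_mul det_mul)
  have "character l \<rho> (g_rot t) = Tr l (\<rho> (transpose cyc) \<circ> (\<rho> ?D \<circ> \<rho> cyc))"
    unfolding character_def g_rot_conj by (rule Tr_cong)
      (simp add: rep_mult SO3_mult rep_in_Sym cl del: scaleR_minus_left)
  also have "\<dots> = Tr l ((\<rho> ?D \<circ> \<rho> cyc) \<circ> \<rho> (transpose cyc))"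
    by (intro Tr_comp_commute linear_on_Sym_comp cl)
  also have "\<dots> = Tr l (\<rho> ?D)"
    by (rule Tr_cong) (simp add: cyc_inverse rep_one cl rep_in_Sym flip: rep_mult del: scaleR_minus_left)
  also have "\<dots> = (\<Sum>k\<le>2 * l. exp (\<i> * (of_nat l - of_nat k) * of_real t))"
    unfolding Tr_def by (intro sum.cong refl, subst rep_E3_mono_form)
      (simp_all add: form_coeff_scale form_coeff_mono_form)
  finally show ?thesis .
qed

end

subsection \<open>Smooth plateau functions\<close>

text \<open>Differentiability to order \<open>n\<close>, in recursive form so that closure
  properties follow by induction on the order. Order 0 imposes nothing, not even continuity.\<close>

primrec C_n :: "nat \<Rightarrow> (real \<Rightarrow> complex) \<Rightarrow> bool" where
  "C_n 0 f \<longleftrightarrow> True"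
| "C_n (Suc n) f \<longleftrightarrow> (\<exists>f'. (\<forall>t. (f has_vector_derivative f' t) (at t)) \<and> C_n n f')"

text \<open>The witnesses hidden in \<open>C_n n f\<close> could vary with \<open>n\<close>, but
  derivatives are unique, so iterating \<open>vector_derivative\<close> yields one sequence that
  serves all orders.\<close>

lemma smooth_on_UNIV_iff: "smooth_on UNIV f \<longleftrightarrow> (\<forall>n. C_n n f)"
proof
  assume "smooth_on UNIV f"
  then obtain g where g: "g 0 = f" "\<And>n t. (g n has_vector_derivative g (Suc n) t) (at t)"
    unfolding smooth_on_def by (metis UNIV_I ext)
  have "C_n n (g m)" for n m
    using g(2) by (induction n arbitrary: m) auto
  with g(1) show "\<forall>n. C_n n f" by metis
next
  assume f: "\<forall>n. C_n n f"
  define D where "D f t = vector_derivative f (at t)" for f :: "real \<Rightarrow> complex" and t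
  have D: "(f has_vector_derivative D f t) (at t) \<and> C_n n (D f)" if "C_n (Suc n) f" for f n t
  proof -
    from that obtain f' where f': "\<And>t. (f has_vector_derivative f' t) (at t)" "C_n n f'" by auto
    moreover from f'(1) have "D f = f'" by (auto simp: D_def vector_derivative_at)
    ultimately show ?thesis by simp
  qed
  have smooth: "C_n n ((D ^^ m) f)" for m n
  proof (induction m arbitrary: n)
    case (Suc m)
    from D[OF Suc.IH] show ?case by simp
  qed (simp add: f)
  have "((D ^^ m) f has_vector_derivative (D ^^ Suc m) f t) (at t)" for m t
    using D[OF smooth[of "Suc 0" m]] by simp
  then show "smooth_on UNIV f"
    unfolding smooth_on_def by (intro exI[of _ "\<lambda>m. (D ^^ m) f"]) simp
qed

lemma C_n_Suc_D: "C_n (Suc n) f \<Longrightarrow> C_n n f"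
proof (induction n arbitrary: f)
  case (Suc n)
  then show ?case by (subst C_n.simps(2), subst (asm) (2) C_n.simps(2)) blast
qed simp

lemma C_n_const: "C_n n (\<lambda>_. c)"
  by (induction n arbitrary: c) (auto intro!: exI[of _ "\<lambda>_. 0"])

lemma C_n_add: "C_n n f \<Longrightarrow> C_n n g \<Longrightarrow> C_n n (\<lambda>t. f t + g t)"
proof (induction n arbitrary: f g)
  case (Suc n)
  then obtain f' g' where "\<And>t. (f has_vector_derivative f' t) (at t)" "C_n n f'"
    "\<And>t. (g has_vector_derivative g' t) (at t)" "C_n n g'" by auto
  then show ?case
    using Suc.IH by (auto intro!: exI[of _ "\<lambda>t. f' t + g' t"] has_vector_derivative_add)
qed simp

lemma C_n_mult: "C_n n f \<Longrightarrow> C_n n g \<Longrightarrow> C_n n (\<lambda>t. f t * g t)"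
proof (induction n arbitrary: f g)
  case (Suc n)
  then obtain f' g' where "\<And>t. (f has_vector_derivative f' t) (at t)" "C_n n f'"
    "\<And>t. (g has_vector_derivative g' t) (at t)" "C_n n g'" by auto
  moreover have "C_n n f" "C_n n g" using Suc.prems by (blast intro: C_n_Suc_D)+
  ultimately show ?case
    using Suc.IH by (auto intro!: exI[of _ "\<lambda>t. f t * g' t + f' t * g t"] has_vector_derivative_mult C_n_add)
qed simp

lemma C_n_affine: "C_n n f \<Longrightarrow> C_n n (\<lambda>t. f (a * t + b))"
proof (induction n arbitrary: f)
  case (Suc n)
  then obtain f' where f': "\<And>t. (f has_vector_derivative f' t) (at t)" "C_n n f'" by auto
  have "((f \<circ> (\<lambda>t. a * t + b)) has_vector_derivative a *\<^sub>R f' (a * t + b)) (at t)" for t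
    by (intro vector_diff_chain_at f') (auto intro!: derivative_eq_intros)
  then have "((\<lambda>t. f (a * t + b)) has_vector_derivative of_real a * f' (a * t + b)) (at t)" for t
    by (simp add: o_def scaleR_conv_of_real)
  with Suc.IH[OF f'(2)] show ?case
    by (auto intro!: exI[of _ "\<lambda>t. of_real a * f' (a * t + b)"] C_n_mult C_n_const)
qed simp

lemma C_n_exp: "C_n n (\<lambda>t. exp (c * of_real t))"
proof (induction n)
  case (Suc n)
  have "((\<lambda>t. exp (c * of_real t)) has_vector_derivative c * exp (c * of_real t)) (at t)" for t
    by (auto intro!: derivative_eq_intros has_vector_derivative_real_field)
  with Suc show ?case
    by (auto intro!: exI[of _ "\<lambda>t. c * exp (c * of_real t)"] C_n_mult C_n_const)
qed simp

section \<open>A smooth function flat at the origin and the plateau built from it\<close>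

lemma tendsto_poly_times_exp_minus:
  fixes p :: "real poly"
  shows "((\<lambda>y. poly p y * exp (- y)) \<longlongrightarrow> 0) at_top"
proof -
  have "((\<lambda>y. \<Sum>i\<le>degree p. coeff p i * (y ^ i / exp y)) \<longlongrightarrow> (\<Sum>i\<le>degree p. coeff p i * 0)) at_top"
    by (intro tendsto_intros tendsto_power_div_exp_0)
  then show ?thesis
    by (simp add: poly_altdef exp_minus divide_inverse sum_distrib_right mult.assoc)
qed

text \<open>In the variable \<open>y = 1 / x\<close> differentiation is \<open>- y\<^sup>2\<close>
  times the derivative in \<open>y\<close>, so it maps a polynomial \<open>p\<close> times
  \<open>exp (- y)\<close> to \<open>y\<^sup>2 * (p - p')\<close> times \<open>exp (- y)\<close>.
  The family is closed under differentiation, across the origin too.\<close>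

lemma flat_has_derivative:
  fixes p :: "real poly"
  defines "q \<equiv> monom 1 2 * (p - pderiv p)"
  shows "((\<lambda>x. if 0 < x then poly p (1 / x) * exp (- (1 / x)) else 0) has_real_derivative
     (if 0 < x then poly q (1 / x) * exp (- (1 / x)) else 0)) (at x)"
    (is "(?f has_real_derivative ?f' x) _")
proof -
  consider "x > 0" | "x < 0" | "x = 0" by linarith
  then show ?thesis
  proof cases
    case 1
    have der: "((\<lambda>x. poly p (1 / x) * exp (- (1 / x))) has_real_derivative ?f' x) (at x)"
      using 1 by (auto intro!: derivative_eq_intros poly_DERIV[THEN DERIV_chain2]
          simp: q_def poly_monom field_simps power2_eq_square)
    have "eventually (\<lambda>x. x \<in> {0<..}) (nhds x)"
      using 1 by (intro eventually_nhds_in_open) auto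
    then have ev: "eventually (\<lambda>x. poly p (1 / x) * exp (- (1 / x)) = ?f x) (nhds x)"
      by eventually_elim auto
    show ?thesis by (rule DERIV_cong_ev[OF refl ev refl, THEN iffD1, OF der])
  next
    case 2
    have "eventually (\<lambda>x. x \<in> {..<0}) (nhds x)"
      using 2 by (intro eventually_nhds_in_open) auto
    then have ev: "eventually (\<lambda>x. 0 = ?f x) (nhds x)"
      by eventually_elim auto
    have "((\<lambda>x. 0) has_real_derivative ?f' x) (at x)" using 2 by simp
    then show ?thesis by (rule DERIV_cong_ev[OF refl ev refl, THEN iffD1])
  next
    case 3
    \<comment> \<open>The difference quotient contributes one more factor \<open>1 / h\<close>,
      which \<open>pCons 0\<close> absorbs into the polynomial.\<close>
    have "((\<lambda>h. poly (pCons 0 p) (inverse h) * exp (- inverse h)) \<longlongrightarrow> 0) (at_right 0)"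
      by (rule filterlim_compose[OF tendsto_poly_times_exp_minus filterlim_inverse_at_top_right])
    moreover have "eventually (\<lambda>h::real. h \<in> {0<..}) (at_right 0)"
      by (auto simp: eventually_at_filter)
    then have "eventually (\<lambda>h. poly (pCons 0 p) (inverse h) * exp (- inverse h) = (?f (0 + h) - ?f 0) / h) (at_right 0)"
      by eventually_elim (auto simp: field_simps)
    ultimately have "((\<lambda>h. (?f (0 + h) - ?f 0) / h) \<longlongrightarrow> 0) (at_right 0)"
      by (rule Lim_transform_eventually)
    moreover have "eventually (\<lambda>h::real. h \<in> {..<0}) (at_left 0)"
      by (auto simp: eventually_at_filter)
    then have "eventually (\<lambda>h. 0 = (?f (0 + h) - ?f 0) / h) (at_left 0)"
      by eventually_elim auto
    then have "((\<lambda>h. (?f (0 + h) - ?f 0) / h) \<longlongrightarrow> 0) (at_left 0)"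
      by (rule Lim_transform_eventually[OF tendsto_const])
    ultimately have "((\<lambda>h. (?f (0 + h) - ?f 0) / h) \<longlongrightarrow> 0) (at 0)"
      by (simp only: filterlim_split_at)
    then show ?thesis using 3 by (simp add: DERIV_def)
  qed
qed

definition flat :: "real \<Rightarrow> real" where
  "flat x = (if 0 < x then exp (- (1 / x)) else 0)"

text \<open>The induction must run over all polynomials at once, since each derivative changes the
  polynomial; the constant polynomial 1 gives \<open>flat\<close>.\<close>

lemma C_n_flat: "C_n n (\<lambda>x. of_real (flat x))"
proof -
  have "C_n n (\<lambda>x. of_real (if 0 < x then poly p (1 / x) * exp (- (1 / x)) else 0))" for p
  proof (induction n arbitrary: p)
    case (Suc n)
    show ?case
      unfolding C_n.simps
      by (intro exI[of _ "\<lambda>x. of_real (if 0 < x then poly (monom 1 2 * (p - pderiv p)) (1 / x) * exp (- (1 / x)) else 0)"]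
          conjI allI has_vector_derivative_of_real Suc.IH
          flat_has_derivative)
  qed simp
  from this[of 1] show ?thesis by (simp add: flat_def[abs_def] cong: if_cong)
qed

lemma flat_nonneg: "0 \<le> flat x" and flat_pos_iff: "0 < flat x \<longleftrightarrow> 0 < x"
  and flat_eq_0_iff: "flat x = 0 \<longleftrightarrow> x \<le> 0"
  by (auto simp: flat_def)

text \<open>A primitive \<open>F\<close> of a bump supported in \<open>[-1, 1]\<close> is a smooth
  step. With \<open>s = (t - t0) / a\<close>, the normalized difference of \<open>F (s + 2)\<close>
  and \<open>F (s - 2)\<close> is 1 while the bump lies between the two arguments and 0 once both
  are on one side of it.\<close>

lemma plateau_function:
  fixes t0 a :: real
  assumes "a > 0"
  obtains \<psi> :: "real \<Rightarrow> real" where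
    "smooth_on UNIV (\<lambda>t. of_real (\<psi> t))"
    "\<And>t. 0 \<le> \<psi> t" "\<And>t. \<psi> t \<le> 1"
    "\<And>t. \<bar>t - t0\<bar> \<le> a \<Longrightarrow> \<psi> t = 1" "\<And>t. 3 * a \<le> \<bar>t - t0\<bar> \<Longrightarrow> \<psi> t = 0"
proof -
  define \<eta> where "\<eta> x = flat (1 * x + 1) * flat ((-1) * x + 1)" for x
  have "C_n n (\<lambda>x. of_real (flat (c * x + 1)))" for n c
    by (rule C_n_affine[OF C_n_flat])
  then have \<eta>_smooth: "C_n n (\<lambda>x. of_real (\<eta> x))" for n
    unfolding \<eta>_def of_real_mult by (intro C_n_mult)
  have cont: "continuous (at x) \<eta>" for x
  proof -
    obtain e' where "((\<lambda>x. of_real (\<eta> x) :: complex) has_vector_derivative e') (at x)"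
      using \<eta>_smooth[of 1] by auto
    then have "continuous (at x) (\<lambda>x. of_real (\<eta> x) :: complex)"
      by (rule has_vector_derivative_continuous)
    then have "continuous (at x) (\<lambda>x. Re (of_real (\<eta> x)))"
      by (rule continuous_Re)
    then show ?thesis by simp
  qed
  obtain F where F: "\<And>x. (F has_real_derivative \<eta> x) (at x)"
    using einterval_antiderivative[of "-\<infinity>" \<infinity> \<eta>] cont
    by (auto simp: has_real_derivative_iff_has_vector_derivative)
  have \<eta>_nonneg: "0 \<le> \<eta> x" and \<eta>_pos: "\<bar>x\<bar> < 1 \<Longrightarrow> 0 < \<eta> x" and \<eta>_zero: "1 \<le> \<bar>x\<bar> \<Longrightarrow> \<eta> x = 0" for x
    unfolding \<eta>_def using flat_nonneg[of "1 * x + 1"] flat_nonneg[of "- 1 * x + 1"]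
      flat_pos_iff[of "1 * x + 1"] flat_pos_iff[of "- 1 * x + 1"]
      flat_eq_0_iff[of "1 * x + 1"] flat_eq_0_iff[of "- 1 * x + 1"] by auto
  have mono: "F x \<le> F y" if "x \<le> y" for x y
    using that(1) by (rule DERIV_nonneg_imp_nondecreasing) (use F \<eta>_nonneg in blast)
  have const: "F x = F y" if "x \<le> y" "y \<le> -1 \<or> 1 \<le> x" for x y
  proof -
    have "\<exists>d. (F has_real_derivative d) (at z) \<and> d \<le> 0" if "x \<le> z" "z \<le> y" for z
    proof -
      have "\<eta> z = 0" using that \<open>y \<le> -1 \<or> 1 \<le> x\<close> by (intro \<eta>_zero) auto
      with F[of z] show ?thesis by auto
    qed
    with that(1) have "F y \<le> F x"
      by (rule DERIV_nonpos_imp_nonincreasing)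
    with mono[OF that(1)] show ?thesis by simp
  qed
  have "F (-1/2) < F (1/2)"
  proof (rule DERIV_pos_imp_increasing[of "-1/2" "1/2" F])
    fix x :: real assume "-1/2 \<le> x" "x \<le> 1/2"
    then have "0 < \<eta> x" by (intro \<eta>_pos) auto
    with F show "\<exists>y. (F has_real_derivative y) (at x) \<and> 0 < y" by blast
  qed simp
  with mono[of "-1" "-1/2"] mono[of "1/2" 1] have I: "0 < F 1 - F (-1)" by simp
  have range: "F (-1) \<le> F x" "F x \<le> F 1" for x
    using const[of x "-1"] mono[of "-1" x] const[of 1 x] mono[of x 1]
    by (metis linear order_refl)+
  \<comment> \<open>The redundant factors and the sums with \<open>-1\<close> give the expression
    the shape that \<open>C_n_mult\<close>, \<open>C_n_add\<close> and \<open>C_n_affine\<close>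
    match.\<close>
  define \<psi> where "\<psi> t = (1 / (F 1 - F (-1))) * (F ((1/a) * t + (2 - t0/a)) + (-1) * F ((1/a) * t + (-2 - t0/a)))" for t
  have F_smooth: "C_n n (\<lambda>x. of_real (F x))" for n
  proof (cases n)
    case (Suc m)
    with \<eta>_smooth[of m] F show ?thesis
      by (auto intro!: exI[of _ "\<lambda>x. of_real (\<eta> x)"] has_vector_derivative_of_real)
  qed simp
  show ?thesis
  proof
    show "smooth_on UNIV (\<lambda>t. of_real (\<psi> t))"
      unfolding smooth_on_UNIV_iff \<psi>_def of_real_mult of_real_add
      by (intro allI C_n_mult C_n_add C_n_const C_n_affine[where f="\<lambda>x. of_real (F x)"] F_smooth)
    fix t
    define s where "s = (t - t0) / a"
    have \<psi>: "\<psi> t = (F (s + 2) - F (s - 2)) / (F 1 - F (-1))"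
      unfolding \<psi>_def s_def by (simp add: diff_divide_distrib algebra_simps)
    show "0 \<le> \<psi> t" unfolding \<psi> using mono[of "s - 2" "s + 2"] I by simp
    show "\<psi> t \<le> 1" unfolding \<psi> using range[of "s - 2"] range[of "s + 2"] I by (simp add: field_simps)
    have s: "\<bar>s\<bar> = \<bar>t - t0\<bar> / a" using assms by (simp add: s_def)
    show "\<psi> t = 1" if "\<bar>t - t0\<bar> \<le> a"
    proof -
      have "\<bar>s\<bar> \<le> 1" unfolding s using that assms by (simp add: field_simps)
      then have "F (s + 2) = F 1" "F (s - 2) = F (-1)"
        using const[of 1 "s + 2"] const[of "s - 2" "-1"] by auto
      then show ?thesis using I by (simp add: \<psi>)
    qed
    show "\<psi> t = 0" if "3 * a \<le> \<bar>t - t0\<bar>"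
    proof -
      have "3 \<le> \<bar>s\<bar>" unfolding s using that assms by (simp add: field_simps)
      then have "F (s + 2) = F (s - 2)"
        using const[of "s - 2" "s + 2"] by (cases "s \<ge> 0") auto
      then show ?thesis by (simp add: \<psi>)
    qed
  qed
qed

subsection \<open>The Abel sum of the characters\<close>

text \<open>Writing \<open>2 * l + 1 = 2 * (l + 1) - 1\<close> reduces it to the geometric series
  and its derivative.\<close>

lemma odd_power_series_sums:
  fixes q :: "'a::{real_normed_field,banach}"
  assumes "norm q < 1"
  shows "(\<lambda>l. of_nat (2 * l + 1) * q ^ l) sums ((1 + q) / (1 - q)\<^sup>2)"
proof -
  have "(\<lambda>l. 2 * (of_nat (Suc l) * q ^ l) - q ^ l) sums (2 * (1 / (1 - q)\<^sup>2) - 1 / (1 - q))"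
    by (intro sums_diff sums_mult geometric_deriv_sums geometric_sums assms)
  moreover have "2 * (1 / (1 - q)\<^sup>2) - 1 / (1 - q) = (1 + q) / (1 - q)\<^sup>2"
    using assms by (auto simp: divide_simps power2_eq_square) (auto simp: algebra_simps)
  ultimately show ?thesis by (simp add: algebra_simps)
qed

text \<open>The square of \<open>2 * l + 1\<close> is
  \<open>8 * ((l + 1) * (l + 2) / 2) - 8 * (l + 1) + 1\<close>, which matches powers of
  \<open>1 / (1 - q)\<close>; the cube arises as a Cauchy product of the square with the geometric
  series.\<close>

lemma odd_square_power_series_sums:
  fixes q :: real
  assumes "norm q < 1"
  shows "(\<lambda>l. q ^ l * (real (2 * l + 1))\<^sup>2) sums (8 / (1 - q) ^ 3 - 8 / (1 - q)\<^sup>2 + 1 / (1 - q))"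
proof -
  have nsum: "summable (\<lambda>l. norm (of_nat (Suc l) * q ^ l))" "summable (\<lambda>l. norm (q ^ l))"
    using sums_summable[OF geometric_deriv_sums, of "norm q"] summable_geometric[of "norm q"] assms
    by (simp_all add: norm_mult norm_power abs_mult power_abs)
  have "(\<Sum>i\<le>n. of_nat (Suc i) * q ^ i * q ^ (n - i)) = (real (n + 1) * real (n + 2) / 2) * q ^ n" for n
  proof -
    have "(\<Sum>i\<le>n. of_nat (Suc i) * q ^ i * q ^ (n - i)) = (\<Sum>i\<le>n. real (Suc i) * q ^ n)"
      by (intro sum.cong refl) (simp add: mult.assoc flip: power_add)
    also have "\<dots> = (\<Sum>i\<le>n. real (Suc i)) * q ^ n" by (simp add: sum_distrib_right)
    also have "(\<Sum>i\<le>n. real (Suc i)) = real (n + 1) * real (n + 2) / 2"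
      by (induction n) (simp_all add: field_simps)
    finally show ?thesis .
  qed
  with Cauchy_product_sums[OF nsum]
  have "(\<lambda>n. (real (n + 1) * real (n + 2) / 2) * q ^ n) sums (1 / (1 - q)\<^sup>2 * (1 / (1 - q)))"
    using assms by (simp add: sums_unique[OF geometric_deriv_sums, symmetric] suminf_geometric del: of_nat_Suc of_nat_add)
  then have "(\<lambda>n. 8 * ((real (n + 1) * real (n + 2) / 2) * q ^ n) - 8 * (of_nat (Suc n) * q ^ n) + q ^ n) sums
     (8 * (1 / (1 - q)\<^sup>2 * (1 / (1 - q))) - 8 * (1 / (1 - q)\<^sup>2) + 1 / (1 - q))"
    by (intro sums_add sums_diff sums_mult geometric_deriv_sums geometric_sums assms)
  moreover have "8 * ((real (n + 1) * real (n + 2) / 2) * q ^ n) - 8 * (of_nat (Suc n) * q ^ n) + q ^ n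
     = q ^ n * (real (2 * n + 1))\<^sup>2" for n
    by (simp add: power2_eq_square algebra_simps)
  ultimately show ?thesis by (simp add: power2_eq_square power3_eq_cube mult.assoc)
qed

section \<open>The characters as Dirichlet kernels\<close>

lemma integrable_indicator_Icc [simp]: "integrable lborel (indicat_real {x..y::real})"
  by (rule integrable_real_indicator) (simp_all add: emeasure_lborel_Icc_eq)

text \<open>The Dirichlet kernel \<open>sin ((l + 1/2) * t) / sin (t / 2)\<close> as a sum of
  exponentials, which also makes sense at periods.\<close>

definition chi :: "nat \<Rightarrow> real \<Rightarrow> complex" where
  "chi l t = (\<Sum>k\<le>2 * l. exp (\<i> * (of_nat l - of_nat k) * of_real t))"

lemma norm_exp_ii_times: "norm (exp (\<i> * (of_nat l - of_nat k) * of_real t)) = 1"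
  by (simp add: norm_exp_eq_Re)

lemma norm_chi_le: "norm (chi l t) \<le> real (2 * l + 1)"
  unfolding chi_def by (rule order.trans[OF norm_sum]) (simp add: norm_exp_ii_times)

lemma continuous_chi: "continuous_on A (chi l)"
  unfolding chi_def[abs_def] by (intro continuous_intros)

text \<open>Telescoping of a geometric sum. It splits the character into two pure powers, so that
  the Abel sum becomes two power series with known closed form.\<close>

lemma chi_geometric:
  "(1 - exp (- \<i> * of_real t)) * chi l t = exp (\<i> * of_real t) ^ l - exp (- \<i> * of_real t) * exp (- \<i> * of_real t) ^ l"
proof -
  have "chi l t = exp (\<i> * of_real t) ^ l * (\<Sum>k\<le>2 * l. exp (- \<i> * of_real t) ^ k)"
    unfolding chi_def sum_distrib_left
    by (intro sum.cong refl) (simp add: algebra_simps flip: exp_of_nat_mult exp_add)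
  then have "(1 - exp (- \<i> * of_real t)) * chi l t
      = exp (\<i> * of_real t) ^ l * ((1 - exp (- \<i> * of_real t)) * (\<Sum>k\<le>2 * l. exp (- \<i> * of_real t) ^ k))"
    by (simp only: mult_ac)
  also have "\<dots> = exp (\<i> * of_real t) ^ l * (1 - exp (- \<i> * of_real t) ^ Suc (2 * l))"
    by (simp only: sum_gp_basic)
  moreover have "exp (\<i> * of_real t) ^ l * exp (- \<i> * of_real t) ^ Suc (2 * l) = exp (- \<i> * of_real t) * exp (- \<i> * of_real t) ^ l"
    by (simp add: algebra_simps flip: exp_of_nat_mult exp_add)
  ultimately show ?thesis by (simp only: right_diff_distrib mult_1_right)
qed

lemma integral_exp_period:
  fixes m :: int
  shows "((\<lambda>t. exp (\<i> * of_int m * of_real t)) has_integral (if m = 0 then complex_of_real (2 * pi) else 0)) {c - pi..c + pi}"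
proof (cases "m = 0")
  case True
  with has_integral_const_real[of "1::complex" "c - pi" "c + pi"] show ?thesis
    by (simp add: scaleR_conv_of_real)
next
  case False
  have "((\<lambda>t. exp (\<i> * of_int m * of_real t)) has_integral
     exp (\<i> * of_int m * of_real (c + pi)) / (\<i> * of_int m) - exp (\<i> * of_int m * of_real (c - pi)) / (\<i> * of_int m)) {c - pi..c + pi}"
    using False by (intro fundamental_theorem_of_calculus)
      (auto intro!: derivative_eq_intros has_vector_derivative_real_field simp: field_simps)
  moreover have "exp (\<i> * of_int m * of_real (c + pi)) = exp (\<i> * of_int m * of_real (c - pi))"
    by (subst exp_eq) (auto intro!: exI[of _ m] simp: algebra_simps)
  ultimately show ?thesis using False by simp
qed

text \<open>Only the zero weight \<open>k = l\<close> has nonzero mean over a period.\<close>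

lemma integral_chi: "(chi l has_integral complex_of_real (2 * pi)) {c - pi..c + pi}"
proof -
  have "((\<lambda>t. \<Sum>k\<le>2 * l. exp (\<i> * of_int (int l - int k) * of_real t)) has_integral
     (\<Sum>k\<le>2 * l. if int l - int k = 0 then complex_of_real (2 * pi) else 0)) {c - pi..c + pi}"
    by (intro has_integral_sum integral_exp_period) simp
  also have "(\<Sum>k\<le>2 * l. if int l - int k = 0 then complex_of_real (2 * pi) else 0) = (\<Sum>k\<le>2 * l. if l = k then complex_of_real (2 * pi) else 0)"
    by (intro sum.cong) auto
  also have "\<dots> = complex_of_real (2 * pi)" by (simp add: sum.delta)
  finally show ?thesis by (simp add: chi_def[abs_def])
qed

definition char_series :: "real \<Rightarrow> real \<Rightarrow> complex" where
  "char_series \<rho> t = (\<Sum>l. of_real (\<rho> ^ l) * of_nat (2 * l + 1) * chi l t)"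

context
  fixes \<rho> :: real
  assumes \<rho>: "0 < \<rho>" "\<rho> < 1"
begin

lemma summable_odd_square: "summable (\<lambda>l. \<rho> ^ l * (real (2 * l + 1))\<^sup>2)"
  using odd_square_power_series_sums[of \<rho>] \<rho> by (auto simp: sums_iff)

lemma char_term_norm_le: "norm (of_real (\<rho> ^ l) * of_nat (2 * l + 1) * chi l t) \<le> \<rho> ^ l * (real (2 * l + 1))\<^sup>2"
proof -
  have "norm (of_real (\<rho> ^ l) * of_nat (2 * l + 1) * chi l t) = \<rho> ^ l * real (2 * l + 1) * norm (chi l t)"
    unfolding norm_mult norm_of_real norm_of_nat using \<rho> by simp
  also have "\<dots> \<le> \<rho> ^ l * real (2 * l + 1) * real (2 * l + 1)"
    using \<rho> by (intro mult_left_mono norm_chi_le) auto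
  finally show ?thesis by (simp only: power2_eq_square mult.assoc)
qed

lemma summable_norm_char_series: "summable (\<lambda>l. norm (of_real (\<rho> ^ l) * of_nat (2 * l + 1) * chi l t))"
  by (rule summable_comparison_test'[OF summable_odd_square]) (simp only: real_norm_def abs_norm_cancel char_term_norm_le)

lemma char_series_sums: "(\<lambda>l. of_real (\<rho> ^ l) * of_nat (2 * l + 1) * chi l t) sums char_series \<rho> t"
  unfolding char_series_def by (rule summable_sums[OF summable_norm_cancel[OF summable_norm_char_series]])

lemma norm_char_series_le: "norm (char_series \<rho> t) \<le> (\<Sum>l. \<rho> ^ l * (real (2 * l + 1))\<^sup>2)"
  unfolding char_series_def
  by (rule order.trans[OF summable_norm[OF summable_norm_char_series]],
      rule suminf_le[OF char_term_norm_le summable_norm_char_series summable_odd_square])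

lemma borel_measurable_char_series: "char_series \<rho> \<in> borel_measurable borel"
proof -
  have "chi l \<in> borel_measurable borel" for l
    by (rule borel_measurable_continuous_onI[OF continuous_chi])
  then show ?thesis unfolding char_series_def[abs_def] by measurable
qed

text \<open>Summing \<open>chi_geometric\<close> gives two odd-weight power series at
  \<open>\<rho> * exp (\<i> * t)\<close> and its conjugate. The factor stays on the left because it
  vanishes at periods.\<close>

lemma char_series_closed_form:
  "(1 - exp (- \<i> * of_real t)) * char_series \<rho> t =
     (1 + of_real \<rho> * exp (\<i> * of_real t)) / (1 - of_real \<rho> * exp (\<i> * of_real t))\<^sup>2
     - exp (- \<i> * of_real t) * ((1 + of_real \<rho> * exp (- \<i> * of_real t)) / (1 - of_real \<rho> * exp (- \<i> * of_real t))\<^sup>2)"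
proof -
  let ?z = "exp (\<i> * of_real t)" and ?w = "exp (- \<i> * of_real t)"
  have "norm (of_real \<rho> * ?z) < 1" "norm (of_real \<rho> * ?w) < 1"
    using \<rho> by (simp_all add: norm_mult norm_exp_eq_Re)
  note odd_power_series_sums[OF this(1)] sums_mult[OF odd_power_series_sums[OF this(2)], of ?w]
  from sums_diff[OF this]
  have "(\<lambda>l. of_nat (2 * l + 1) * (of_real \<rho> * ?z) ^ l - ?w * (of_nat (2 * l + 1) * (of_real \<rho> * ?w) ^ l)) sums
    ((1 + of_real \<rho> * ?z) / (1 - of_real \<rho> * ?z)\<^sup>2 - ?w * ((1 + of_real \<rho> * ?w) / (1 - of_real \<rho> * ?w)\<^sup>2))" .
  moreover have "of_nat (2 * l + 1) * (of_real \<rho> * ?z) ^ l - ?w * (of_nat (2 * l + 1) * (of_real \<rho> * ?w) ^ l)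
     = (1 - ?w) * (of_real (\<rho> ^ l) * of_nat (2 * l + 1) * chi l t)" for l
  proof -
    have "of_nat (2 * l + 1) * (of_real \<rho> * ?z) ^ l - ?w * (of_nat (2 * l + 1) * (of_real \<rho> * ?w) ^ l)
      = of_real (\<rho> ^ l) * of_nat (2 * l + 1) * (?z ^ l - ?w * ?w ^ l)"
      by (simp only: power_mult_distrib of_real_power right_diff_distrib mult_ac)
    also have "\<dots> = (1 - ?w) * (of_real (\<rho> ^ l) * of_nat (2 * l + 1) * chi l t)"
      unfolding chi_geometric[symmetric] by (simp only: mult_ac)
    finally show ?thesis .
  qed
  ultimately have "(\<lambda>l. (1 - ?w) * (of_real (\<rho> ^ l) * of_nat (2 * l + 1) * chi l t)) sums
    ((1 + of_real \<rho> * ?z) / (1 - of_real \<rho> * ?z)\<^sup>2 - ?w * ((1 + of_real \<rho> * ?w) / (1 - of_real \<rho> * ?w)\<^sup>2))"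
    by simp
  from sums_unique2[OF sums_mult[OF char_series_sums] this] show ?thesis .
qed

text \<open>In the closed form both denominators and the factor on the left are differences between
  1 and a point of the closed unit disc with argument away from 0; each has modulus at least
  \<open>sin a\<close>, whatever \<open>\<rho>\<close> is.\<close>

lemma norm_char_series_off_diagonal:
  assumes a: "0 < a" "a \<le> pi / 2" and t: "cos t \<le> cos a"
  shows "norm (char_series \<rho> t) \<le> 4 / sin a ^ 3"
proof -
  have sin: "0 < sin a" using a by (intro sin_gt_zero) auto
  \<comment> \<open>\<open>sin a\<close> is the distance from 1 to the line spanned by
    \<open>exp (\<i> * a)\<close>; completing the square in \<open>r\<close> shows it. The case
    \<open>r = 1\<close> serves the factor in front of the series.\<close>
  have bound: "sin a \<le> norm (1 - of_real r * exp (\<i> * of_real s))"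
    if "0 \<le> r" "r \<le> 1" "cos s \<le> cos a" for r s
  proof (rule power2_le_imp_le)
    have "(sin a)\<^sup>2 = 1 - (cos a)\<^sup>2" by (simp add: sin_squared_eq)
    also have "\<dots> \<le> 1 - (cos a)\<^sup>2 + (r - cos a)\<^sup>2" by simp
    also have "\<dots> = 1 - 2 * r * cos a + r\<^sup>2" by (simp add: power2_eq_square algebra_simps)
    also have "\<dots> \<le> 1 - 2 * r * cos s + r\<^sup>2" using that by (simp add: mult_left_mono)
    also have "\<dots> = (1 - r * cos s)\<^sup>2 + (r * sin s)\<^sup>2"
      using sin_cos_squared_add[of s] by (simp add: power2_diff power_mult_distrib) (simp add: algebra_simps flip: distrib_left)
    also have "\<dots> = (norm (1 - of_real r * exp (\<i> * of_real s)))\<^sup>2"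
      by (simp add: cmod_power2 Re_exp Im_exp)
    finally show "(sin a)\<^sup>2 \<le> (norm (1 - of_real r * exp (\<i> * of_real s)))\<^sup>2" .
  qed simp
  let ?z = "exp (\<i> * of_real t)" and ?w = "exp (- \<i> * of_real t)"
  have frac: "norm ((1 + of_real \<rho> * exp (\<i> * of_real s)) / (1 - of_real \<rho> * exp (\<i> * of_real s))\<^sup>2) \<le> 2 / (sin a)\<^sup>2"
    if "cos s \<le> cos a" for s
  proof -
    have "norm (1 + of_real \<rho> * exp (\<i> * of_real s)) \<le> 2"
      using \<rho> by (intro norm_triangle_le) (simp add: norm_mult norm_exp_eq_Re)
    moreover have "(sin a)\<^sup>2 \<le> (norm (1 - of_real \<rho> * exp (\<i> * of_real s)))\<^sup>2"
      using sin \<rho> that by (intro power_mono bound) auto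
    ultimately show ?thesis using sin unfolding norm_divide norm_power by (intro frac_le) auto
  qed
  have "sin a * norm (char_series \<rho> t) \<le> norm (1 - ?w) * norm (char_series \<rho> t)"
    using bound[of 1 "- t"] t by (intro mult_right_mono) auto
  also have "\<dots> \<le> norm ((1 + of_real \<rho> * ?z) / (1 - of_real \<rho> * ?z)\<^sup>2)
     + norm (?w * ((1 + of_real \<rho> * ?w) / (1 - of_real \<rho> * ?w)\<^sup>2))"
    unfolding norm_mult[symmetric] char_series_closed_form by (rule norm_triangle_ineq4)
  also have "\<dots> \<le> 2 / (sin a)\<^sup>2 + 2 / (sin a)\<^sup>2"
  proof (intro add_mono)
    have "norm (?w * x) = norm x" for x by (simp add: norm_mult norm_exp_eq_Re)
    moreover have "?w = exp (\<i> * of_real (- t))" by simp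
    ultimately show "norm (?w * ((1 + of_real \<rho> * ?w) / (1 - of_real \<rho> * ?w)\<^sup>2)) \<le> 2 / (sin a)\<^sup>2"
      using frac[of "- t"] t by (simp only: cos_minus)
  qed (rule frac[OF t])
  finally show ?thesis using sin by (simp add: field_simps power2_eq_square power3_eq_cube)
qed

text \<open>Termwise integration, justified by the summable bound
  \<open>2 * pi * (\<rho> ^ l * (2 * l + 1)\<^sup>2)\<close> on the integrals of the norms. Each
  character contributes \<open>2 * pi\<close>.\<close>

lemma char_series_integral:
  defines "I \<equiv> \<lambda>c. {c - pi..c + pi}"
  shows "integrable lborel (\<lambda>t. indicator (I c) t *\<^sub>R char_series \<rho> t)"
    and "(LINT t|lborel. indicator (I c) t *\<^sub>R char_series \<rho> t) = of_real (2 * pi * ((1 + \<rho>) / (1 - \<rho>)\<^sup>2))"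
proof -
  let ?f = "\<lambda>l t. indicator (I c) t *\<^sub>R (of_real (\<rho> ^ l) * of_nat (2 * l + 1) * chi l t)"
  have int: "integrable lborel (?f l)" for l
  proof -
    have "continuous_on (I c) (\<lambda>t. of_real (\<rho> ^ l) * of_nat (2 * l + 1) * chi l t)"
      by (intro continuous_on_mult_left continuous_chi)
    then have "set_integrable lborel (I c) (\<lambda>t. of_real (\<rho> ^ l) * of_nat (2 * l + 1) * chi l t)"
      unfolding I_def by (rule borel_integrable_atLeastAtMost')
    then show ?thesis by (simp only: set_integrable_def)
  qed
  have val: "(LINT t|lborel. ?f l t) = of_real (2 * pi) * (of_nat (2 * l + 1) * of_real \<rho> ^ l)" for l
  proof -
    have "((\<lambda>t. of_real (\<rho> ^ l) * of_nat (2 * l + 1) * chi l t) has_integral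
        of_real (\<rho> ^ l) * of_nat (2 * l + 1) * complex_of_real (2 * pi)) (I c)"
      unfolding I_def by (intro has_integral_mult_right integral_chi)
    moreover have "(LINT t:I c|lborel. of_real (\<rho> ^ l) * of_nat (2 * l + 1) * chi l t)
       = integral (I c) (\<lambda>t. of_real (\<rho> ^ l) * of_nat (2 * l + 1) * chi l t)"
      using int[of l] by (intro set_borel_integral_eq_integral) (simp add: set_integrable_def)
    ultimately have "(LINT t|lborel. ?f l t) = of_real (\<rho> ^ l) * of_nat (2 * l + 1) * complex_of_real (2 * pi)"
      by (simp only: set_lebesgue_integral_def integral_unique)
    then show ?thesis by (simp only: of_real_power mult_ac)
  qed
  have S: "(\<Sum>l. ?f l t) = indicator (I c) t *\<^sub>R char_series \<rho> t" for t
    by (cases "t \<in> I c") (simp_all add: char_series_def)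
  have norm_le: "norm (?f l t) \<le> indicator (I c) t *\<^sub>R (\<rho> ^ l * (real (2 * l + 1))\<^sup>2)" for l t
    using char_term_norm_le[of l t] by (cases "t \<in> I c") simp_all
  have AE: "AE t in lborel. summable (\<lambda>l. norm (?f l t))"
  proof (rule AE_I2)
    fix t
    show "summable (\<lambda>l. norm (?f l t))"
      using summable_norm_char_series[of t] by (cases "t \<in> I c") simp_all
  qed
  have sum: "summable (\<lambda>l. LINT t|lborel. norm (?f l t))"
  proof (rule summable_comparison_test')
    show "summable (\<lambda>l. 2 * pi * (\<rho> ^ l * (real (2 * l + 1))\<^sup>2))"
      by (intro summable_mult summable_odd_square)
    fix l
    have "(LINT t|lborel. norm (?f l t)) \<le> (LINT t|lborel. indicator (I c) t *\<^sub>R (\<rho> ^ l * (real (2 * l + 1))\<^sup>2))"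
      by (intro integral_mono integrable_norm int norm_le) (simp add: I_def)
    also have "\<dots> = 2 * pi * (\<rho> ^ l * (real (2 * l + 1))\<^sup>2)"
      by (simp add: I_def)
    finally show "norm (LINT t|lborel. norm (?f l t)) \<le> 2 * pi * (\<rho> ^ l * (real (2 * l + 1))\<^sup>2)"
      by simp
  qed
  show "integrable lborel (\<lambda>t. indicator (I c) t *\<^sub>R char_series \<rho> t)"
    using integrable_suminf[OF int AE sum] unfolding S .
  have "(\<lambda>l. LINT t|lborel. ?f l t) sums (LINT t|lborel. indicator (I c) t *\<^sub>R char_series \<rho> t)"
    using sums_integral[OF int AE sum] unfolding S .
  moreover have "(\<lambda>l. LINT t|lborel. ?f l t) sums
      (of_real (2 * pi) * ((1 + of_real \<rho>) / (1 - of_real \<rho>)\<^sup>2))"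
    unfolding val by (intro sums_mult odd_power_series_sums) (use \<rho> in simp)
  ultimately show "(LINT t|lborel. indicator (I c) t *\<^sub>R char_series \<rho> t) = of_real (2 * pi * ((1 + \<rho>) / (1 - \<rho>)\<^sup>2))"
    by (simp add: sums_iff)
qed

end

subsection \<open>Divergence of the pairing\<close>

lemma filterlim_inverse_one_minus_at_left_1: "filterlim (\<lambda>\<rho>::real. 1 / (1 - \<rho>)) at_top (at_left 1)"
proof -
  have "filterlim (\<lambda>\<rho>::real. 1 - \<rho>) (at_right 0) (at_left 1)"
    by (auto simp: filterlim_at eventually_at_filter intro!: tendsto_eq_intros)
  from filterlim_compose[OF filterlim_inverse_at_top_right this] show ?thesis
    by (simp add: inverse_eq_divide)
qed

text \<open>Replacing \<open>\<psi>\<close> by the indicator of a full period \<open>I\<close> costs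
  at most \<open>C\<close> pointwise, since the kernel is bounded by \<open>C\<close> where
  \<open>\<psi>\<close> differs from 1 on \<open>I\<close>. The term \<open>H\<close> costs at most
  \<open>B\<close> on the interval \<open>J\<close> of length \<open>6 * a\<close> outside which
  \<open>\<psi>\<close> vanishes.\<close>

lemma char_series_pairing_ge:
  fixes \<psi> :: "real \<Rightarrow> real" and H :: "real \<Rightarrow> complex"
  assumes \<rho>: "0 < \<rho>" "\<rho> < 1" and a: "0 < a" "a \<le> 1 / 4"
    and per: "\<And>t. cos t = cos (t - t0)"
    and \<psi>: "\<psi> \<in> borel_measurable borel" "\<And>t. 0 \<le> \<psi> t" "\<And>t. \<psi> t \<le> 1"
      "\<And>t. \<bar>t - t0\<bar> \<le> a \<Longrightarrow> \<psi> t = 1" "\<And>t. 3 * a \<le> \<bar>t - t0\<bar> \<Longrightarrow> \<psi> t = 0"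
    and H: "H \<in> borel_measurable borel" "\<And>t. norm (H t) \<le> B"
  shows "2 * pi * ((1 + \<rho>) / (1 - \<rho>)\<^sup>2) - 2 * pi * (4 / sin a ^ 3) - 6 * a * B \<le>
    Re (LINT t|lborel. of_real (\<psi> t) * (char_series \<rho> t - H t))"
proof -
  define I where "I = {t0 - pi..t0 + pi}"
  define J where "J = {t0 - 3 * a..t0 + 3 * a}"
  define C where "C = 4 / sin a ^ 3"
  define T where "T = (\<Sum>l. \<rho> ^ l * (real (2 * l + 1))\<^sup>2)"
  let ?K = "char_series \<rho>"
  have "0 \<le> B" using H(2)[of 0] norm_ge_zero order_trans by blast
  have "0 < sin a" using a pi_gt3 by (intro sin_gt_zero) auto
  then have C: "0 \<le> C" by (simp add: C_def)
  have int: "integrable lborel (\<lambda>t. of_real (\<psi> t) * (?K t - H t))"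
  proof (rule Bochner_Integration.integrable_bound)
    \<comment> \<open>The bound \<open>T\<close> grows with \<open>\<rho>\<close> and only secures
      integrability; the estimate itself uses \<open>C\<close>.\<close>
    show "integrable lborel (\<lambda>t. indicator J t *\<^sub>R (T + B))"
      unfolding J_def by simp
    show "(\<lambda>t. of_real (\<psi> t) * (?K t - H t)) \<in> borel_measurable lborel"
      using \<psi>(1) H(1) borel_measurable_char_series[OF \<rho>] by measurable
    show "AE t in lborel. norm (of_real (\<psi> t) * (?K t - H t)) \<le> norm (indicator J t *\<^sub>R (T + B))"
    proof (rule AE_I2)
      fix t
      have KH: "norm (?K t - H t) \<le> T + B"
        using norm_triangle_ineq4[of "?K t" "H t"] norm_char_series_le[OF \<rho>, of t] H(2)[of t]
        by (simp add: T_def)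
      have "norm (of_real (\<psi> t) * (?K t - H t)) \<le> indicator J t * (T + B)"
      proof (cases "t \<in> J")
        case True
        then show ?thesis
          using \<psi>(2,3)[of t] KH mult_mono[of "\<psi> t" 1 "norm (?K t - H t)" "T + B"] by (simp add: norm_mult)
      next
        case False
        then have "\<psi> t = 0" by (intro \<psi>(5)) (auto simp: J_def abs_if)
        then show ?thesis using False by simp
      qed
      then show "norm (of_real (\<psi> t) * (?K t - H t)) \<le> norm (indicator J t *\<^sub>R (T + B))"
        by simp
    qed
  qed
  have le: "Re (indicator I t *\<^sub>R ?K t) - indicator I t *\<^sub>R C - indicator J t *\<^sub>R B \<le> Re (of_real (\<psi> t) * (?K t - H t))" for t
  proof -
    have JI: "J \<subseteq> I" using a pi_gt3 by (auto simp: I_def J_def)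
    have ReH: "\<psi> t * Re (H t) \<le> indicator J t * B"
    proof (cases "t \<in> J")
      case True
      have "\<psi> t * Re (H t) \<le> \<psi> t * B"
        using \<psi>(2)[of t] H(2)[of t] complex_Re_le_cmod[of "H t"] by (intro mult_left_mono) auto
      also have "\<dots> \<le> 1 * B" using \<psi>(3)[of t] \<open>0 \<le> B\<close> by (intro mult_right_mono)
      finally show ?thesis using True by simp
    next
      case False
      then have "\<psi> t = 0" by (intro \<psi>(5)) (auto simp: J_def abs_if)
      then show ?thesis using False by simp
    qed
    have ReK: "indicator I t * (Re (?K t) - C) \<le> \<psi> t * Re (?K t)"
    proof (cases "t \<in> I")
      case False
      with JI have "t \<notin> J" by blast
      then have "\<psi> t = 0" by (intro \<psi>(5)) (auto simp: J_def abs_if)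
      then show ?thesis using False by simp
    next
      case True
      show ?thesis
      proof (cases "\<bar>t - t0\<bar> \<le> a")
        case True
        then show ?thesis using \<psi>(4)[OF True] \<open>t \<in> I\<close> C by simp
      next
        case False
        have "cos t = cos \<bar>t - t0\<bar>" using per[of t] by simp
        also have "\<dots> \<le> cos a" using False True a by (intro cos_monotone_0_pi_le) (auto simp: I_def)
        finally have "norm (?K t) \<le> C"
          unfolding C_def using a pi_gt3 by (intro norm_char_series_off_diagonal[OF \<rho>]) auto
        then have "Re (?K t) \<le> C" using complex_Re_le_cmod[of "?K t"] by linarith
        \<comment> \<open>What the cutoff removes from the kernel is at most
          \<open>C\<close>.\<close>
        then have "(1 - \<psi> t) * Re (?K t) \<le> (1 - \<psi> t) * C"
          using \<psi>(3)[of t] by (intro mult_left_mono) auto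
        also have "\<dots> \<le> 1 * C" using \<psi>(2)[of t] C by (intro mult_right_mono) auto
        finally show ?thesis using \<open>t \<in> I\<close> by (simp add: algebra_simps)
      qed
    qed
    show ?thesis using ReH ReK by (simp add: algebra_simps)
  qed
  note K = char_series_integral[OF \<rho>, of t0, folded I_def]
  have "has_bochner_integral lborel (\<lambda>t. Re (indicator I t *\<^sub>R ?K t)) (2 * pi * ((1 + \<rho>) / (1 - \<rho>)\<^sup>2))"
    unfolding has_bochner_integral_iff using integrable_Re[OF K(1)] integral_Re[OF K(1)]
    by (simp only: K(2) Re_complex_of_real)
  moreover have "has_bochner_integral lborel (\<lambda>t. indicator I t *\<^sub>R C) (2 * pi * C)"
    by (simp add: has_bochner_integral_iff I_def)
  moreover have "has_bochner_integral lborel (\<lambda>t. indicator J t *\<^sub>R B) (6 * a * B)"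
    using a by (simp add: has_bochner_integral_iff J_def)
  ultimately have lower: "has_bochner_integral lborel
      (\<lambda>t. Re (indicator I t *\<^sub>R ?K t) - indicator I t *\<^sub>R C - indicator J t *\<^sub>R B)
      (2 * pi * ((1 + \<rho>) / (1 - \<rho>)\<^sup>2) - 2 * pi * C - 6 * a * B)"
    by (intro has_bochner_integral_diff)
  then have "2 * pi * ((1 + \<rho>) / (1 - \<rho>)\<^sup>2) - 2 * pi * C - 6 * a * B
     = (LINT t|lborel. Re (indicator I t *\<^sub>R ?K t) - indicator I t *\<^sub>R C - indicator J t *\<^sub>R B)"
    by (rule has_bochner_integral_integral_eq[symmetric])
  also have "\<dots> \<le> (LINT t|lborel. Re (of_real (\<psi> t) * (?K t - H t)))"
    using lower int
    by (intro integral_mono le integrable_Re) (auto simp: has_bochner_integral_iff)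
  also have "\<dots> = Re (LINT t|lborel. of_real (\<psi> t) * (?K t - H t))"
    using int by (rule integral_Re)
  finally show ?thesis by (simp add: C_def)
qed

text \<open>The mass \<open>2 * pi * S\<close> of the kernel outweighs a perturbation of size
  \<open>2 * S + M\<close> on a short interval, where
  \<open>S = (1 + \<rho>) / (1 - \<rho>)\<^sup>2\<close>, so one test function has pairings tending
  to infinity, whereas a limit would make them converge.\<close>

lemma not_smooth_abel_limit_near:
  assumes H: "\<And>\<rho>. 0 < \<rho> \<Longrightarrow> \<rho> < 1 \<Longrightarrow> H \<rho> \<in> borel_measurable borel"
      "\<And>\<rho> t. 0 < \<rho> \<Longrightarrow> \<rho> < 1 \<Longrightarrow> norm (H \<rho> t) \<le> 2 * ((1 + \<rho>) / (1 - \<rho>)\<^sup>2) + M"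
    and G: "\<And>\<rho> t. 0 < \<rho> \<Longrightarrow> \<rho> < 1 \<Longrightarrow> G \<rho> t = exp (\<i> * of_real t / 2) * (char_series \<rho> t - H \<rho> t)"
  shows "\<not> smooth_abel_limit_near (2 * pi * of_int k) G"
proof
  define t0 :: real where "t0 = 2 * pi * of_int k"
  assume "smooth_abel_limit_near (2 * pi * of_int k) G"
  then obtain U f where U: "open U" "t0 \<in> U" and lim: "abel_limit_on U G f"
    unfolding smooth_abel_limit_near_def t0_def by blast
  from U obtain d where d: "d > 0" "cball t0 d \<subseteq> U" by (meson open_contains_cball)
  \<comment> \<open>\<open>d / 3\<close> keeps the support of the plateau, of radius
    \<open>3 * a\<close>, inside \<open>U\<close>; \<open>1 / 4\<close> gives
    \<open>12 * a \<le> 3\<close>.\<close>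
  define a where "a = min (d / 3) (1 / 4)"
  have a: "0 < a" "a \<le> 1 / 4" "3 * a \<le> d" using d by (auto simp: a_def min_def)
  obtain \<psi> where \<psi>: "smooth_on UNIV (\<lambda>t. of_real (\<psi> t))" "\<And>t. 0 \<le> \<psi> t" "\<And>t. \<psi> t \<le> 1"
    "\<And>t. \<bar>t - t0\<bar> \<le> a \<Longrightarrow> \<psi> t = 1" "\<And>t. 3 * a \<le> \<bar>t - t0\<bar> \<Longrightarrow> \<psi> t = 0"
    using plateau_function[OF a(1), of t0] by metis
  define \<phi> where "\<phi> t = exp (- \<i> / 2 * of_real t) * of_real (\<psi> t)" for t
  have supp: "closure {t. \<phi> t \<noteq> 0} \<subseteq> cball t0 (3 * a)"
  proof (rule closure_minimal)
    show "{t. \<phi> t \<noteq> 0} \<subseteq> cball t0 (3 * a)"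
      using \<psi>(5) by (force simp: \<phi>_def dist_real_def abs_minus_commute)
  qed simp
  have "test_function U \<phi>"
    unfolding test_function_def
  proof (intro conjI)
    show "smooth_on UNIV \<phi>"
      using \<psi>(1) unfolding smooth_on_UNIV_iff \<phi>_def[abs_def] by (intro allI C_n_mult C_n_exp) blast
    show "compact (closure {t. \<phi> t \<noteq> 0})"
      using supp bounded_subset[OF bounded_cball] by (simp add: compact_eq_bounded_closed)
    show "closure {t. \<phi> t \<noteq> 0} \<subseteq> U"
      using supp d a by (meson dual_order.trans subset_cball)
  qed
  with lim have tends: "((\<lambda>\<rho>. Re (LINT t|lborel. G \<rho> t * \<phi> t)) \<longlongrightarrow> Re (LINT t|lborel. f t * \<phi> t)) (at_left 1)"
    unfolding abel_limit_on_def by (intro tendsto_Re) blast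
  have \<psi>_meas: "\<psi> \<in> borel_measurable borel"
  proof -
    have "C_n 1 (\<lambda>t. of_real (\<psi> t))" using \<psi>(1) unfolding smooth_on_UNIV_iff by blast
    then obtain \<psi>' where \<psi>': "\<And>t. ((\<lambda>t. of_real (\<psi> t) :: complex) has_vector_derivative \<psi>' t) (at t)"
      by auto
    have "continuous_on UNIV (\<lambda>t. of_real (\<psi> t) :: complex)"
      by (rule continuous_at_imp_continuous_on) (use has_vector_derivative_continuous[OF \<psi>'] in blast)
    then have "continuous_on UNIV (\<lambda>t. Re (of_real (\<psi> t)))" by (rule continuous_on_Re)
    then show ?thesis by (intro borel_measurable_continuous_onI) simp
  qed
  have per: "cos t = cos (t - t0)" for t
    by (simp add: t0_def cos_diff)
  define X where "X = 2 * pi * (4 / sin a ^ 3) + 6 * a * M"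
  have ge: "1 / (1 - \<rho>) - X \<le> Re (LINT t|lborel. G \<rho> t * \<phi> t)" if \<rho>: "0 < \<rho>" "\<rho> < 1" for \<rho>
  proof -
    define S where "S = (1 + \<rho>) / (1 - \<rho>)\<^sup>2"
    have S: "1 / (1 - \<rho>) \<le> S"
      using \<rho> by (simp add: S_def power2_eq_square divide_simps)
    then have "0 \<le> S" using \<rho> by (smt (verit) divide_nonneg_pos)
    \<comment> \<open>Net coefficient of \<open>S\<close>: \<open>2 * pi\<close> from the kernel
      minus \<open>6 * a * 2\<close> from the perturbation, at least 1 by the choice of
      \<open>a\<close>.\<close>
    have "1 * S \<le> (2 * pi - 12 * a) * S"
      using a pi_gt3 \<open>0 \<le> S\<close> by (intro mult_right_mono) auto
    then have "1 / (1 - \<rho>) - X \<le> 2 * pi * S - 2 * pi * (4 / sin a ^ 3) - 6 * a * (2 * S + M)"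
      using S by (simp add: X_def algebra_simps)
    also have "\<dots> \<le> Re (LINT t|lborel. of_real (\<psi> t) * (char_series \<rho> t - H \<rho> t))"
      unfolding S_def using \<rho> a(1,2) per \<psi>_meas \<psi>(2-5) H by (intro char_series_pairing_ge) auto
    also have "(\<lambda>t. of_real (\<psi> t) * (char_series \<rho> t - H \<rho> t)) = (\<lambda>t. G \<rho> t * \<phi> t)"
      using G[OF \<rho>] by (auto simp: \<phi>_def mult_ac simp flip: exp_add)
    finally show ?thesis .
  qed
  let ?L = "Re (LINT t|lborel. f t * \<phi> t)"
  have "eventually (\<lambda>\<rho>. Re (LINT t|lborel. G \<rho> t * \<phi> t) < ?L + 1) (at_left 1)"
    by (rule order_tendstoD(2)[OF tends]) simp
  moreover have "eventually (\<lambda>\<rho>. ?L + 1 + X \<le> 1 / (1 - \<rho>)) (at_left (1::real))"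
    using filterlim_inverse_one_minus_at_left_1 by (simp add: filterlim_at_top)
  moreover have "eventually (\<lambda>\<rho>. \<rho> \<in> {0<..<1}) (at_left (1::real))"
    by (rule eventually_at_left_real) simp
  ultimately have "eventually (\<lambda>\<rho>. False) (at_left (1::real))"
    by eventually_elim (use ge in force)
  then show False by simp
qed

subsection \<open>Traces with Hardy projectors\<close>

lemma SO3_one: "mat 1 \<in> SO3"
  using g_rot_SO3[of 0] by (simp add: g_rot_eq SO3_def rotation_matrix_def orthogonal_matrix_id det_I)

definition weighted_series :: "(nat \<Rightarrow> complex) \<Rightarrow> real \<Rightarrow> complex" where
  "weighted_series f \<rho> = (\<Sum>l. of_real (\<rho> ^ l) * of_nat (2 * l + 1) * f l)"

text \<open>Comparison with the odd-weight series at \<open>\<rho> * c\<close>. Equal projectors use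
  \<open>c = 1\<close>; mixed ones use \<open>c = 1/2\<close>, where the bound stays finite as
  \<open>\<rho>\<close> tends to 1.\<close>

lemma weighted_series:
  assumes "0 < \<rho>" "\<rho> < 1" and f: "\<And>l. norm (f l) \<le> c ^ l" and c: "0 < c" "c \<le> 1"
  shows "(\<lambda>l. of_real (\<rho> ^ l) * of_nat (2 * l + 1) * f l) sums weighted_series f \<rho>"
    and "norm (weighted_series f \<rho>) \<le> (1 + \<rho> * c) / (1 - \<rho> * c)\<^sup>2"
proof -
  have "\<rho> * c < 1" using assms mult_less_le_imp_less[of \<rho> 1 c 1] by simp
  then have S: "(\<lambda>l. real (2 * l + 1) * (\<rho> * c) ^ l) sums ((1 + \<rho> * c) / (1 - \<rho> * c)\<^sup>2)"
    using odd_power_series_sums[of "\<rho> * c"] assms by simp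
  have le: "norm (of_real (\<rho> ^ l) * of_nat (2 * l + 1) * f l) \<le> real (2 * l + 1) * (\<rho> * c) ^ l" for l
  proof -
    have "norm (of_real (\<rho> ^ l) * of_nat (2 * l + 1) * f l) = \<rho> ^ l * real (2 * l + 1) * norm (f l)"
      unfolding norm_mult norm_of_real norm_of_nat using assms by simp
    also have "\<dots> \<le> \<rho> ^ l * real (2 * l + 1) * c ^ l"
      using assms by (intro mult_left_mono) auto
    finally show ?thesis by (simp only: power_mult_distrib mult_ac)
  qed
  have sm: "summable (\<lambda>l. norm (of_real (\<rho> ^ l) * of_nat (2 * l + 1) * f l))"
    by (rule summable_comparison_test'[OF sums_summable[OF S]]) (simp only: real_norm_def abs_norm_cancel le)
  show "(\<lambda>l. of_real (\<rho> ^ l) * of_nat (2 * l + 1) * f l) sums weighted_series f \<rho>"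
    unfolding weighted_series_def by (rule summable_sums[OF summable_norm_cancel[OF sm]])
  show "norm (weighted_series f \<rho>) \<le> (1 + \<rho> * c) / (1 - \<rho> * c)\<^sup>2"
    unfolding weighted_series_def sums_unique[OF S]
    by (rule order.trans[OF summable_norm[OF sm]], rule suminf_le[OF le sm sums_summable[OF S]])
qed

lemma half_series_le: "0 < \<rho> \<Longrightarrow> \<rho> < 1 \<Longrightarrow> (1 + \<rho> * (1/2)) / (1 - \<rho> * (1/2))\<^sup>2 \<le> (6::real)"
proof -
  assume \<rho>: "0 < \<rho>" "\<rho> < 1"
  then have "(1/2)\<^sup>2 \<le> (1 - \<rho> * (1/2))\<^sup>2" by (intro power_mono) auto
  then have "(1 + \<rho> * (1/2)) / (1 - \<rho> * (1/2))\<^sup>2 \<le> (3/2) / (1/2)\<^sup>2"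
    using \<rho> by (intro frac_le) auto
  then show ?thesis by (simp add: power2_eq_square)
qed

context
  fixes l :: nat and \<rho> :: "real^3^3 \<Rightarrow> bipoly \<Rightarrow> bipoly" and v w :: bipoly
  assumes model: "SO3_model_rep l \<rho>"
    and v: "v \<in> Sym l" "form_norm l v > 0" and w: "w \<in> Sym l" "form_norm l w > 0"
begin

text \<open>Of the two factors in \<open>Tr_line_proj\<close>, the matrix coefficient is at most 1
  by unitarity and Cauchy-Schwarz, which leaves the overlap.\<close>

lemma norm_Tr_projections_le:
  assumes g: "g \<in> SO3"
  shows "norm (Tr l (line_proj l v \<circ> \<rho> g \<circ> line_proj l w)) \<le> norm (ip l (normalize_form l v) (normalize_form l w))"
proof -
  have "norm (ip l (\<rho> g (normalize_form l w)) (normalize_form l v)) \<le> 1"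
    using ip_Cauchy_Schwarz[of l "\<rho> g (normalize_form l w)" "normalize_form l v"]
    by (simp add: rep_norm[OF model g] Sym_normalize normalize_form_norm v w)
  from mult_right_mono[OF this norm_ge_zero] show ?thesis
    by (simp add: Tr_line_proj[OF rep_linear[OF model g] w(1)] norm_mult)
qed

lemma Tr_projections_one:
  "Tr l (line_proj l v \<circ> \<rho> (mat 1) \<circ> line_proj l w) = of_real ((cmod (ip l (normalize_form l v) (normalize_form l w)))\<^sup>2)"
  unfolding Tr_line_proj[OF rep_linear[OF model SO3_one] w(1)] rep_one[OF model Sym_normalize[OF w(1)]]
    complex_norm_square ip_cnj[of l "normalize_form l w"]
  by (simp add: mult.commute)

lemma borel_measurable_Tr_projections:
  "(\<lambda>t. Tr l (line_proj l v \<circ> \<rho> (g_rot t) \<circ> line_proj l w)) \<in> borel_measurable borel"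
proof -
  have "continuous_on UNIV (\<lambda>t. ip l (\<rho> (g_rot t) (normalize_form l w)) (normalize_form l v))"
    by (rule continuous_on_compose2[OF rep_continuous[OF model] continuous_g_rot])
       (auto simp: g_rot_SO3 Sym_normalize v w)
  then have "continuous_on UNIV (\<lambda>t. Tr l (line_proj l v \<circ> \<rho> (g_rot t) \<circ> line_proj l w))"
    unfolding Tr_line_proj[OF rep_linear[OF model g_rot_SO3] w(1)] by (intro continuous_on_mult_right)
  then show ?thesis by (rule borel_measurable_continuous_onI)
qed

end

section \<open>The four traces, their bounds, and the values at periods\<close>

context
  fixes \<tau> :: real and R :: "nat \<Rightarrow> real^3^3 \<Rightarrow> bipoly \<Rightarrow> bipoly"
  assumes \<tau>: "\<tau> > 0" and model: "\<And>l. SO3_model_rep l (R l)"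
begin

definition proj_trace ::
  "(nat \<Rightarrow> bipoly) \<Rightarrow> (nat \<Rightarrow> bipoly) \<Rightarrow> real \<Rightarrow> nat \<Rightarrow> complex" where
  "proj_trace v w t l = Tr l (line_proj l (v l) \<circ> R l (g_rot t) \<circ> line_proj l (w l))"

lemmas u_w = u_vec_in_Sym w_vec_in_Sym form_norm_u_vec form_norm_w_vec_pos[OF \<tau>]

lemma norm_proj_trace_le:
  "norm (proj_trace u_vec u_vec t l) \<le> 1 ^ l" "norm (proj_trace (w_vec \<tau>) (w_vec \<tau>) t l) \<le> 1 ^ l"
  "norm (proj_trace u_vec (w_vec \<tau>) t l) \<le> (1/2) ^ l" "norm (proj_trace (w_vec \<tau>) u_vec t l) \<le> (1/2) ^ l"
proof -
  have n: "norm (proj_trace v w t l) \<le> norm (ip l (normalize_form l (v l)) (normalize_form l (w l)))"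
    if "v \<in> {u_vec, w_vec \<tau>}" "w \<in> {u_vec, w_vec \<tau>}" for v w
    unfolding proj_trace_def using that by (intro norm_Tr_projections_le model g_rot_SO3) (auto simp: u_w)
  have "norm (ip l (normalize_form l v) (normalize_form l v)) = 1" if "form_norm l v > 0" for v
    by (simp add: ip_self_norm normalize_form_norm that)
  with n[of u_vec u_vec] n[of "w_vec \<tau>" "w_vec \<tau>"]
  show "norm (proj_trace u_vec u_vec t l) \<le> 1 ^ l" "norm (proj_trace (w_vec \<tau>) (w_vec \<tau>) t l) \<le> 1 ^ l"
    by (auto simp: u_w)
  show "norm (proj_trace (w_vec \<tau>) u_vec t l) \<le> (1/2) ^ l"
    using n[of "w_vec \<tau>" u_vec] cmod_ip_w_u_le[OF \<tau>, of l] by auto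
  have "norm (ip l (normalize_form l (u_vec l)) (normalize_form l (w_vec \<tau> l))) \<le> (1/2) ^ l"
    unfolding ip_cnj[of l "normalize_form l (u_vec l)"] complex_mod_cnj by (rule cmod_ip_w_u_le[OF \<tau>])
  with n[of u_vec "w_vec \<tau>"] show "norm (proj_trace u_vec (w_vec \<tau>) t l) \<le> (1/2) ^ l" by auto
qed

lemma proj_trace_period:
  "proj_trace u_vec u_vec (2 * pi * of_int k) l = 1"
  "proj_trace (w_vec \<tau>) (w_vec \<tau>) (2 * pi * of_int k) l = 1"
  "proj_trace u_vec (w_vec \<tau>) (2 * pi * of_int k) l = of_real (s_coef \<tau> l)"
  "proj_trace (w_vec \<tau>) u_vec (2 * pi * of_int k) l = of_real (s_coef \<tau> l)"
  unfolding proj_trace_def g_rot_period s_coef_def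
  by (simp_all add: Tr_projections_one[OF model] u_w ip_self_norm normalize_form_norm
      ip_cnj[of l "normalize_form l (u_vec l)" "normalize_form l (w_vec \<tau> l)"])

definition proj_series :: "real \<Rightarrow> real \<Rightarrow> complex" where
  "proj_series \<rho> t =
     weighted_series (proj_trace u_vec u_vec t) \<rho> + weighted_series (proj_trace (w_vec \<tau>) (w_vec \<tau>) t) \<rho> +
     weighted_series (proj_trace u_vec (w_vec \<tau>) t) \<rho> + weighted_series (proj_trace (w_vec \<tau>) u_vec t) \<rho>"

lemma H_abel_eq: "H_abel R \<tau> \<rho> t = exp (\<i> * of_real t / 2) * proj_series \<rho> t"
proof -
  have P: "P_h = (\<lambda>l. line_proj l (u_vec l))" "P_tau \<tau> = (\<lambda>l. line_proj l (w_vec \<tau> l))"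
    by (auto simp: P_h_def P_tau_def)
  show ?thesis
    unfolding H_abel_def T_abel_def proj_series_def weighted_series_def proj_trace_def P
    by (simp only: distrib_left)
qed

lemma F_abel_eq: "F_abel R \<rho> t = exp (\<i> * of_real t / 2) * char_series \<rho> t"
  unfolding F_abel_def char_series_def character_g_rot[OF model] chi_def ..

lemma D_abel_eq: "D_abel R \<tau> \<rho> t = exp (\<i> * of_real t / 2) * (char_series \<rho> t - proj_series \<rho> t)"
  by (simp add: D_abel_def H_abel_eq F_abel_eq algebra_simps)

text \<open>Each trace with equal projectors contributes the full odd-weight sum, each mixed one at
  most 6.\<close>

lemma norm_proj_series_le:
  assumes \<rho>: "0 < \<rho>" "\<rho> < 1"
  shows "norm (proj_series \<rho> t) \<le> 2 * ((1 + \<rho>) / (1 - \<rho>)\<^sup>2) + 12"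
proof -
  define S where "S = (1 + \<rho>) / (1 - \<rho>)\<^sup>2"
  have one: "norm (weighted_series f \<rho>) \<le> S" if "\<And>l. norm (f l) \<le> 1 ^ l" for f
    using weighted_series(2)[OF \<rho> that] by (simp add: S_def)
  have half: "norm (weighted_series f \<rho>) \<le> 6" if "\<And>l. norm (f l) \<le> (1/2) ^ l" for f
    using order.trans[OF weighted_series(2)[OF \<rho> that] half_series_le[OF \<rho>]] by simp
  have "norm (proj_series \<rho> t) \<le> S + S + 6 + 6"
    unfolding proj_series_def by (intro norm_triangle_mono one half norm_proj_trace_le)
  then show ?thesis unfolding S_def[symmetric] by simp
qed

lemma borel_measurable_proj_series: "proj_series \<rho> \<in> borel_measurable borel"
proof -
  have [measurable]: "(\<lambda>t. proj_trace v w t l) \<in> borel_measurable borel"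
    if "v \<in> {u_vec, w_vec \<tau>}" "w \<in> {u_vec, w_vec \<tau>}" for v w l
    unfolding proj_trace_def using that by (intro borel_measurable_Tr_projections model) (auto simp: u_w)
  have "(\<lambda>t. weighted_series (proj_trace v w t) \<rho>) \<in> borel_measurable borel"
    if "v \<in> {u_vec, w_vec \<tau>}" "w \<in> {u_vec, w_vec \<tau>}" for v w
    using that unfolding weighted_series_def by measurable
  then show ?thesis
    unfolding proj_series_def[abs_def] by (intro borel_measurable_add) blast+
qed

lemma D_abel_not_smooth: "\<not> smooth_abel_limit_near (2 * pi * of_int k) (D_abel R \<tau>)"
  by (rule not_smooth_abel_limit_near[OF borel_measurable_proj_series norm_proj_series_le D_abel_eq])

text \<open>At a period the characters are \<open>2 * l + 1\<close>, the equal traces 1 and the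
  mixed ones \<open>s_coef \<tau> l\<close>. The closed forms give the three singular terms exactly;
  the remainder is twice the series of \<open>s_coef\<close>, which is at most 6 in modulus.\<close>

lemma D_abel_period_sums:
  assumes \<rho>: "0 < \<rho>" "\<rho> < 1"
  shows "\<exists>S. (\<lambda>l. \<rho> ^ l * real (2 * l + 1) * (real (2 * l + 1) - 2 - 2 * s_coef \<tau> l)) sums S \<and>
    D_abel R \<tau> \<rho> (2 * pi * of_int k) = (-1) powi k * of_real S \<and>
    \<bar>S - (8 / (1 - \<rho>) ^ 3 - 12 / (1 - \<rho>)\<^sup>2 + 3 / (1 - \<rho>))\<bar> \<le> 12"
proof -
  define t where "t = 2 * pi * of_int k"
  have exp: "exp (\<i> * of_real t / 2) = (-1) powi k"
  proof -
    have "exp (\<i> * of_real t / 2) = exp (of_int k * (\<i> * of_real pi))" by (simp add: t_def mult_ac)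
    also have "\<dots> = exp (\<i> * of_real pi) powi k" by (simp only: exp_power_int)
    finally show ?thesis by (simp add: mult.commute)
  qed
  have chi: "chi l t = of_nat (2 * l + 1)" for l
  proof -
    have "chi l t = Tr l (R l (mat 1))"
      using character_g_rot[OF model, of l t] by (simp add: chi_def character_def t_def g_rot_period)
    also have "\<dots> = of_nat (2 * l + 1)"
      by (simp add: Tr_def rep_one[OF model] mono_form_in_Sym form_coeff_mono_form)
    finally show ?thesis .
  qed
  \<comment> \<open>The general bound on mixed traces, read at a period, where such a trace equals
    \<open>s_coef \<tau> l\<close>.\<close>
  have half: "norm (of_real (s_coef \<tau> l) :: complex) \<le> (1/2) ^ l" for l
    using norm_proj_trace_le(3)[of t l] unfolding t_def proj_trace_period .
  define Q where "Q = weighted_series (\<lambda>l. of_real (s_coef \<tau> l)) \<rho>"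
  have Q: "(\<lambda>l. of_real (\<rho> ^ l) * of_nat (2 * l + 1) * of_real (s_coef \<tau> l)) sums Q" "norm Q \<le> 6"
    using weighted_series[OF \<rho> half] half_series_le[OF \<rho>] by (auto simp: Q_def)
  have one: "weighted_series (\<lambda>l. 1) \<rho> = of_real ((1 + \<rho>) / (1 - \<rho>)\<^sup>2)"
    using sums_of_real[OF odd_power_series_sums[of \<rho>], where 'a=complex] \<rho>
    by (simp add: weighted_series_def sums_iff mult.commute)
  have square: "char_series \<rho> t = of_real (8 / (1 - \<rho>) ^ 3 - 8 / (1 - \<rho>)\<^sup>2 + 1 / (1 - \<rho>))"
    using sums_of_real[OF odd_square_power_series_sums[of \<rho>], where 'a=complex] \<rho>
    by (simp add: char_series_def chi sums_iff power2_eq_square mult.assoc)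
  have proj: "proj_series \<rho> t = 2 * of_real ((1 + \<rho>) / (1 - \<rho>)\<^sup>2) + 2 * Q"
    unfolding proj_series_def t_def proj_trace_period[abs_def] one Q_def by simp
  have "(\<lambda>l. of_real (\<rho> ^ l) * of_nat (2 * l + 1) * chi l t
       - 2 * (of_real (\<rho> ^ l) * of_nat (2 * l + 1) * 1)
       - 2 * (of_real (\<rho> ^ l) * of_nat (2 * l + 1) * of_real (s_coef \<tau> l))) sums
     (char_series \<rho> t - 2 * weighted_series (\<lambda>l. 1) \<rho> - 2 * Q)"
    by (intro sums_diff sums_mult char_series_sums[OF \<rho>] Q(1) weighted_series(1)[OF \<rho>, of _ 1]) simp_all
  then have "(\<lambda>l. complex_of_real (\<rho> ^ l * real (2 * l + 1) * (real (2 * l + 1) - 2 - 2 * s_coef \<tau> l))) sums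
     (char_series \<rho> t - proj_series \<rho> t)"
    unfolding chi one proj by (simp add: algebra_simps)
  note S = this
  from sums_Re[OF S] have sums: "(\<lambda>l. \<rho> ^ l * real (2 * l + 1) * (real (2 * l + 1) - 2 - 2 * s_coef \<tau> l)) sums
      Re (char_series \<rho> t - proj_series \<rho> t)"
    by (simp only: Re_complex_of_real)
  \<comment> \<open>The difference is the sum of a series of real terms, so it equals its real
    part.\<close>
  have real: "of_real (Re (char_series \<rho> t - proj_series \<rho> t)) = char_series \<rho> t - proj_series \<rho> t"
    by (rule sums_unique2[OF sums_of_real[OF sums] S])
  have "Re (char_series \<rho> t - proj_series \<rho> t) - (8 / (1 - \<rho>) ^ 3 - 12 / (1 - \<rho>)\<^sup>2 + 3 / (1 - \<rho>)) = - 2 * Re Q"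
  proof -
    have "8 / (1 - \<rho>) ^ 3 - 8 / (1 - \<rho>)\<^sup>2 + 1 / (1 - \<rho>) - 2 * ((1 + \<rho>) / (1 - \<rho>)\<^sup>2) =
      8 / (1 - \<rho>) ^ 3 - 12 / (1 - \<rho>)\<^sup>2 + 3 / (1 - \<rho>)"
    proof -
      define x where "x = 1 - \<rho>"
      have x: "\<rho> = 1 - x" "x \<noteq> 0" using \<rho> by (simp_all add: x_def)
      have "(1 + \<rho>) / x\<^sup>2 = 2 / x\<^sup>2 - 1 / x"
        using x(2) unfolding x(1) by (simp add: field_simps power2_eq_square)
      then show ?thesis unfolding x_def[symmetric] by simp
    qed
    moreover have "Re (char_series \<rho> t - proj_series \<rho> t) =
      8 / (1 - \<rho>) ^ 3 - 8 / (1 - \<rho>)\<^sup>2 + 1 / (1 - \<rho>) - 2 * ((1 + \<rho>) / (1 - \<rho>)\<^sup>2) - 2 * Re Q"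
      unfolding square proj minus_complex.sel plus_complex.sel Re_complex_of_real by simp
    ultimately show ?thesis by simp
  qed
  moreover have "\<bar>Re Q\<bar> \<le> 6" using abs_Re_le_cmod[of Q] Q(2) by simp
  ultimately show ?thesis
    using sums real by (intro exI[of _ "Re (char_series \<rho> t - proj_series \<rho> t)"])
      (auto simp: D_abel_eq exp simp flip: t_def)
qed

end

theorem theorem9p3:
  fixes \<tau> :: real and R :: "nat \<Rightarrow> real^3^3 \<Rightarrow> bipoly \<Rightarrow> bipoly"
  assumes "\<tau> > 0"
    and "\<And>l. SO3_model_rep l (R l)"
  shows
    "\<not> (\<exists>f. smooth_on UNIV f \<and> abel_limit_on UNIV (D_abel R \<tau>) f) \<and>
     (\<forall>k::int. \<not> smooth_abel_limit_near (2 * pi * of_int k) (D_abel R \<tau>)) \<and>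
     (\<forall>k::int. \<forall>\<rho>. 0 < \<rho> \<and> \<rho> < 1 \<longrightarrow>
        summable (\<lambda>l. \<rho> ^ l * real (2 * l + 1) * (real (2 * l + 1) - 2 - 2 * s_coef \<tau> l)) \<and>
        D_abel R \<tau> \<rho> (2 * pi * of_int k) =
          (-1) powi k * of_real (\<Sum>l. \<rho> ^ l * real (2 * l + 1) *
             (real (2 * l + 1) - 2 - 2 * s_coef \<tau> l))) \<and>
     (\<exists>C. \<forall>\<^sub>F \<rho> in at_left 1. \<forall>k::int.
        cmod (D_abel R \<tau> \<rho> (2 * pi * of_int k) -
              (-1) powi k * of_real (8 / (1 - \<rho>) ^ 3 - 12 / (1 - \<rho>)\<^sup>2 + 3 / (1 - \<rho>))) \<le> C) \<and>
     (\<forall>k::int. \<not> eq_mod_smooth_near (2 * pi * of_int k) (F_abel R) (H_abel R \<tau>))"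
proof (intro conjI allI impI)
  note not_smooth = D_abel_not_smooth[OF assms]
  note period = D_abel_period_sums[OF assms]
  show "\<not> smooth_abel_limit_near (2 * pi * of_int k) (D_abel R \<tau>)" for k
    by (rule not_smooth)
  \<comment> \<open>A global smooth limit would be a local one near the period 0, with
    \<open>U = UNIV\<close>.\<close>
  show "\<not> (\<exists>f. smooth_on UNIV f \<and> abel_limit_on UNIV (D_abel R \<tau>) f)"
    using not_smooth[of 0] unfolding smooth_abel_limit_near_def by blast
  show "\<not> eq_mod_smooth_near (2 * pi * of_int k) (F_abel R) (H_abel R \<tau>)" for k
    using not_smooth[of k] unfolding eq_mod_smooth_near_def D_abel_def[abs_def] .
  show "summable (\<lambda>l. \<rho> ^ l * real (2 * l + 1) * (real (2 * l + 1) - 2 - 2 * s_coef \<tau> l))"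
    and "D_abel R \<tau> \<rho> (2 * pi * of_int k) =
          (-1) powi k * of_real (\<Sum>l. \<rho> ^ l * real (2 * l + 1) *
             (real (2 * l + 1) - 2 - 2 * s_coef \<tau> l))" if "0 < \<rho> \<and> \<rho> < 1" for \<rho> k
    using period[of \<rho> k] that by (auto simp: sums_iff)
  \<comment> \<open>The sign has modulus 1, so the remainder bound 12 holds for all periods and all
    \<open>\<rho>\<close> at once.\<close>
  have "cmod (D_abel R \<tau> \<rho> (2 * pi * of_int k) -
      (-1) powi k * of_real (8 / (1 - \<rho>) ^ 3 - 12 / (1 - \<rho>)\<^sup>2 + 3 / (1 - \<rho>))) \<le> 12"
    if \<rho>: "0 < \<rho>" "\<rho> < 1" for \<rho> k
  proof -
    from period[OF \<rho>, of k] obtain S where S: "D_abel R \<tau> \<rho> (2 * pi * of_int k) = (-1) powi k * of_real S"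
      "\<bar>S - (8 / (1 - \<rho>) ^ 3 - 12 / (1 - \<rho>)\<^sup>2 + 3 / (1 - \<rho>))\<bar> \<le> 12" by blast
    then show ?thesis
      unfolding S(1) right_diff_distrib[symmetric] of_real_diff[symmetric] norm_mult norm_of_real
      by (simp add: norm_power_int)
  qed
  moreover have "eventually (\<lambda>\<rho>. \<rho> \<in> {0<..<1}) (at_left (1::real))"
    by (rule eventually_at_left_real) simp
  ultimately show "\<exists>C. \<forall>\<^sub>F \<rho> in at_left 1. \<forall>k::int.
        cmod (D_abel R \<tau> \<rho> (2 * pi * of_int k) -
              (-1) powi k * of_real (8 / (1 - \<rho>) ^ 3 - 12 / (1 - \<rho>)\<^sup>2 + 3 / (1 - \<rho>))) \<le> C"
    by (intro exI[of _ 12]) (auto elim: eventually_mono)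
qed

end
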